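(* Let $T,\rho\in(0,\infty)$, $d\in\mathbb N$, $\varrho=\sqrt{2T\rho}$, let $\varphi\colon\mathbb R^d\to\mathbb R$ be a function, let $u\in C^{1,2}([0,T]\times\mathbb R^d,\mathbb R)$ have at most polynomially growing partial derivatives, assume for all $t\in[0,T]$, $x\in\mathbb R^d$ that $u(0,x)=\varphi(x)$ and $$\tfrac{\partial u}{\partial t}(t,x)=\rho\,\Delta_xu(t,x),$$ let $(\Omega,\mathcal F,\mathbb P)$ be a probability space, let $\mathbb B\colon\Omega\to\mathbb R^d$ and $\xi\colon\Omega\to\mathbb R^d$ be standard normal random variables, assume that $\mathbb B$ and $\xi$ are independent, let $V=C(\mathbb R^d,\mathbb R)$, and let $\ell\colon V\to[0,\infty]$ satisfy for all $v\in V$ that $$\ell(v)=\mathbb E\bigl[|\varphi(\varrho\,\mathbb B+\xi)-v(\xi)|^2\bigr].$$ Then (i) for all $v\in V$ it holds that $\ell(v)=\inf_{w\in V}\ell(w)$ if and only if it holds for all $x\in\mathbb R^d$ that $v(x)=u(T,x)$, and (ii) there exists $v\in V$ such that $\ell(v)=\inf_{w\in V}\ell(w)$.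
   Context: $\mathbb N=\{1,2,3,\dots\}$. $C(\mathbb R^d,\mathbb R)$ is the set of continuous functions from $\mathbb R^d$ to $\mathbb R$. $C^{1,2}([0,T]\times\mathbb R^d,\mathbb R)$ is the set of continuous functions $(t,x)\mapsto u(t,x)$ which are once continuously differentiable in $t\in[0,T]$ (one-sided at the endpoints) and twice continuously differentiable in $x\in\mathbb R^d$, with all these partial derivatives jointly continuous. That $u$ has at most polynomially growing partial derivatives means that there is $c\in(0,\infty)$ such that each of these partial derivatives (first order in $t$, first and second order in $x$) is bounded in absolute value by $c(1+\|x\|^c)$ for all $(t,x)\in[0,T]\times\mathbb R^d$, where $\|\cdot\|$ is the Euclidean norm. $\Delta_x$ is the Laplacian in the variable $x$. A standard normal random variable in $\mathbb R^d$ has distribution $\mathcal N(0,I_d)$. *)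

theory Defs
  imports "HOL-Probability.Probability"
begin

text \<open>
  The Euclidean space of dimension d is the type \<open>real ^ 'n\<close> with d = \<open>CARD('n)\<close>.
  A function on [0,T] x R^d is a total curried function \<open>u\<close>; only its values at times
  in \<open>{0..T}\<close> enter the definitions below.
\<close>

text \<open>One-sided at the endpoints of \<open>{0..T}\<close>.\<close>

definition time_deriv :: "real \<Rightarrow> (real \<Rightarrow> real ^ 'n \<Rightarrow> real) \<Rightarrow> real \<Rightarrow> real ^ 'n \<Rightarrow> real" where
  "time_deriv T u t x = vector_derivative (\<lambda>s. u s x) (at t within {0..T})"

definition has_partial :: "'n \<Rightarrow> (real ^ 'n \<Rightarrow> real) \<Rightarrow> real ^ 'n \<Rightarrow> bool" where
  "has_partial i f x \<longleftrightarrow> (\<lambda>h. f (x + h *\<^sub>R axis i 1)) differentiable (at 0)"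

definition partial :: "'n \<Rightarrow> (real ^ 'n \<Rightarrow> real) \<Rightarrow> real ^ 'n \<Rightarrow> real" where
  "partial i f x = deriv (\<lambda>h. f (x + h *\<^sub>R axis i 1)) 0"

definition laplacian :: "(real ^ 'n \<Rightarrow> real) \<Rightarrow> real ^ 'n \<Rightarrow> real" where
  "laplacian f x = (\<Sum>i\<in>UNIV. partial i (partial i f) x)"

definition C12 :: "real \<Rightarrow> (real \<Rightarrow> real ^ 'n \<Rightarrow> real) set" where
  "C12 T = {u.
     continuous_on ({0..T} \<times> UNIV) (\<lambda>(t, x). u t x) \<and>
     (\<forall>t\<in>{0..T}. \<forall>x. (\<lambda>s. u s x) differentiable (at t within {0..T})) \<and>
     continuous_on ({0..T} \<times> UNIV) (\<lambda>(t, x). time_deriv T u t x) \<and>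
     (\<forall>i. (\<forall>t\<in>{0..T}. \<forall>x. has_partial i (u t) x) \<and>
          continuous_on ({0..T} \<times> UNIV) (\<lambda>(t, x). partial i (u t) x)) \<and>
     (\<forall>i j. (\<forall>t\<in>{0..T}. \<forall>x. has_partial j (partial i (u t)) x) \<and>
          continuous_on ({0..T} \<times> UNIV) (\<lambda>(t, x). partial j (partial i (u t)) x))}"

definition poly_growing_derivs :: "real \<Rightarrow> (real \<Rightarrow> real ^ 'n \<Rightarrow> real) \<Rightarrow> bool" where
  "poly_growing_derivs T u \<longleftrightarrow>
     (\<exists>c>0. \<forall>t\<in>{0..T}. \<forall>x.
        \<bar>time_deriv T u t x\<bar> \<le> c * (1 + norm x powr c) \<and>
        (\<forall>i. \<bar>partial i (u t) x\<bar> \<le> c * (1 + norm x powr c)) \<and>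
        (\<forall>i j. \<bar>partial j (partial i (u t)) x\<bar> \<le> c * (1 + norm x powr c)))"

text \<open>The distribution N(0, I), given by its Lebesgue density.\<close>

definition standard_normal :: "'w measure \<Rightarrow> ('w \<Rightarrow> real ^ 'n) \<Rightarrow> bool" where
  "standard_normal M X \<longleftrightarrow>
     distributed M lborel X
       (\<lambda>x. ennreal (exp (- (norm x)\<^sup>2 / 2) / sqrt (2 * pi) ^ CARD('n)))"

end

theory Submission
  imports Defs
begin

text \<open>
  Conditionally on \<open>\<xi> = x\<close>, the bias-variance decomposition turns the loss into a finite constant plus
  the mean of \<open>(E \<phi>(x + \<rho>' B) - v x)\<^sup>2\<close>, so everything rests on \<open>E \<phi>(x + \<rho>' B) = u T x\<close>.
  For this, \<open>t \<mapsto> E u(t, x + sqrt (2 \<rho> (T - t)) B)\<close> is constant on \<open>[0, T)\<close>: writing it as the integral of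
  \<open>u t\<close> against a heat kernel, one differentiates only in \<open>t\<close> and moves the Laplacian onto the kernel,
  which uses partial derivatives along the axes but no chain rule for \<open>u\<close>. Let \<open>t\<close> tend to \<open>T\<close>.
\<close>

text \<open>The kernel \<open>exp (- \<alpha> t * (norm y)\<^sup>2)\<close> with
  \<open>\<alpha> t = 1 / (4 * \<rho> * (T - t))\<close> degenerates at \<open>T\<close>, so the
  same mean is used in two forms. With \<open>y\<close> as integration variable, the spatial
  argument of \<open>u\<close> does not move with \<open>t\<close>, and differentiating under the
  integral is legitimate on every \<open>{0..b}\<close> with \<open>b < T\<close>. After the
  substitution \<open>y = \<sigma> t *\<^sub>R z\<close> the Gaussian weight is fixed, and the limit
  at \<open>T\<close> is a matter of dominated convergence. The growth hypothesis bounds derivatives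
  only; the growth of \<open>u\<close> itself has to be recovered from it. Competitors
  \<open>v\<close> are arbitrary continuous functions whose loss may be infinite. Hence the
  decomposition is done with nonnegative integrals, pointwise in \<open>x\<close>, and only the
  minimal value has to be finite: it is then cancelled to see that a minimiser agrees with
  \<open>u T\<close> almost everywhere.\<close>

text \<open>
  Growth below every Gaussian, uniformly in the parameter. Quantifying over all exponents, unlike fixing one,
  makes the class closed under products.
\<close>

definition subgauss :: "'k set \<Rightarrow> ('k \<Rightarrow> 'a::real_normed_vector \<Rightarrow> real) \<Rightarrow> bool" where
  "subgauss S f \<longleftrightarrow> (\<forall>a>0. \<exists>C. \<forall>t\<in>S. \<forall>y. \<bar>f t y\<bar> \<le> C * exp (a * (norm y)\<^sup>2))"

section \<open>Closure properties of sub-Gaussian growth\<close>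

lemma subgaussD:
  assumes "subgauss S f" "a > 0"
  obtains C where "C \<ge> 0" "\<And>t y. t \<in> S \<Longrightarrow> \<bar>f t y\<bar> \<le> C * exp (a * (norm y)\<^sup>2)"
proof -
  obtain C where C: "\<forall>t\<in>S. \<forall>y. \<bar>f t y\<bar> \<le> C * exp (a * (norm y)\<^sup>2)"
    using assms unfolding subgauss_def by blast
  \<comment> \<open>For empty \<open>S\<close> the constant may be negative, hence
    \<open>max C 0\<close>.\<close>
  have "\<bar>f t y\<bar> \<le> max C 0 * exp (a * (norm y)\<^sup>2)" if "t \<in> S" for t y
  proof -
    have "C * exp (a * (norm y)\<^sup>2) \<le> max C 0 * exp (a * (norm y)\<^sup>2)"
      by (rule mult_right_mono) auto
    with C that show ?thesis by (meson order_trans)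
  qed
  then show ?thesis using that[of "max C 0"] by auto
qed

text \<open>The index type of the result is free: a single function is encoded as a family over
  \<open>{()}\<close>.\<close>

lemma subgauss_at: "subgauss S f \<Longrightarrow> t \<in> S \<Longrightarrow> subgauss S' (\<lambda>_. f t)"
  unfolding subgauss_def by meson

lemma subgauss_subset: "subgauss S f \<Longrightarrow> S' \<subseteq> S \<Longrightarrow> subgauss S' f"
  unfolding subgauss_def by (meson subsetD)

lemma subgauss_mono:
  assumes "subgauss S g" "\<And>t y. t \<in> S \<Longrightarrow> \<bar>f t y\<bar> \<le> \<bar>g t y\<bar>"
  shows "subgauss S f"
  using assms unfolding subgauss_def by (meson order_trans)

lemma subgauss_const: "subgauss S (\<lambda>_ _. c)"
  unfolding subgauss_def
proof (intro allI impI exI ballI)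
  fix a :: real and t y assume "a > 0"
  have "\<bar>c\<bar> * 1 \<le> \<bar>c\<bar> * exp (a * (norm y)\<^sup>2)"
    using \<open>a > 0\<close> by (intro mult_left_mono) auto
  then show "\<bar>c\<bar> \<le> \<bar>c\<bar> * exp (a * (norm y)\<^sup>2)" by simp
qed

lemma subgauss_add:
  assumes "subgauss S f" "subgauss S g"
  shows "subgauss S (\<lambda>t y. f t y + g t y)"
  unfolding subgauss_def
proof (intro allI impI)
  fix a :: real assume a: "a > 0"
  obtain C where C: "\<And>t y. t \<in> S \<Longrightarrow> \<bar>f t y\<bar> \<le> C * exp (a * (norm y)\<^sup>2)"
    by (rule subgaussD[OF assms(1) a]) blast
  obtain D where D: "\<And>t y. t \<in> S \<Longrightarrow> \<bar>g t y\<bar> \<le> D * exp (a * (norm y)\<^sup>2)"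
    by (rule subgaussD[OF assms(2) a]) blast
  have "\<bar>f t y + g t y\<bar> \<le> (C + D) * exp (a * (norm y)\<^sup>2)" if "t \<in> S" for t y
    using C[OF that, of y] D[OF that, of y] by (simp add: distrib_right)
  then show "\<exists>C. \<forall>t\<in>S. \<forall>y. \<bar>f t y + g t y\<bar> \<le> C * exp (a * (norm y)\<^sup>2)" by blast
qed

lemma subgauss_mult:
  assumes "subgauss S f" "subgauss S g"
  shows "subgauss S (\<lambda>t y. f t y * g t y)"
  unfolding subgauss_def
proof (intro allI impI)
  fix a :: real assume a: "a > 0"
  then have a2: "a / 2 > 0" by simp
  obtain C where C: "C \<ge> 0" "\<And>t y. t \<in> S \<Longrightarrow> \<bar>f t y\<bar> \<le> C * exp (a / 2 * (norm y)\<^sup>2)"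
    by (rule subgaussD[OF assms(1) a2]) blast
  obtain D where D: "D \<ge> 0" "\<And>t y. t \<in> S \<Longrightarrow> \<bar>g t y\<bar> \<le> D * exp (a / 2 * (norm y)\<^sup>2)"
    by (rule subgaussD[OF assms(2) a2]) blast
  have "\<bar>f t y * g t y\<bar> \<le> (C * D) * exp (a * (norm y)\<^sup>2)" if "t \<in> S" for t y
  proof -
    have "\<bar>f t y * g t y\<bar> \<le> (C * exp (a / 2 * (norm y)\<^sup>2)) * (D * exp (a / 2 * (norm y)\<^sup>2))"
      unfolding abs_mult using C D that by (intro mult_mono) auto
    also have "\<dots> = (C * D) * (exp (a / 2 * (norm y)\<^sup>2) * exp (a / 2 * (norm y)\<^sup>2))"
      by simp
    also have "\<dots> = (C * D) * exp (a * (norm y)\<^sup>2)"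
      by (simp only: exp_add[symmetric] distrib_right[symmetric] field_sum_of_halves)
    finally show ?thesis .
  qed
  then show "\<exists>C. \<forall>t\<in>S. \<forall>y. \<bar>f t y * g t y\<bar> \<le> C * exp (a * (norm y)\<^sup>2)" by blast
qed

text \<open>Combines \<open>2 * norm y <= 1 + (norm y)\<^sup>2\<close> with
  \<open>s <= exp s\<close> at \<open>s = a * (norm y)\<^sup>2\<close>.\<close>

lemma subgauss_norm: "subgauss S (\<lambda>_ y. norm y)"
  unfolding subgauss_def
proof (intro allI impI exI ballI)
  fix a :: real and t and y :: 'b assume a: "a > 0"
  have "a * (norm y)\<^sup>2 \<le> exp (a * (norm y)\<^sup>2)"
    using exp_ge_add_one_self[of "a * (norm y)\<^sup>2"] by linarith
  then have "(norm y)\<^sup>2 \<le> exp (a * (norm y)\<^sup>2) / a"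
    using a by (simp add: pos_le_divide_eq mult.commute)
  moreover have "2 * norm y \<le> 1 + (norm y)\<^sup>2"
    using sum_squares_bound[of 1 "norm y"] by simp
  moreover have "1 \<le> exp (a * (norm y)\<^sup>2)" using a by simp
  ultimately have "2 * norm y \<le> exp (a * (norm y)\<^sup>2) + exp (a * (norm y)\<^sup>2) / a" by linarith
  also have "\<dots> = (1 + 1 / a) * exp (a * (norm y)\<^sup>2)" by (simp add: field_simps)
  finally have *: "2 * norm y \<le> (1 + 1 / a) * exp (a * (norm y)\<^sup>2)" .
  show "\<bar>norm y\<bar> \<le> (1 + 1 / a) * exp (a * (norm y)\<^sup>2)"
    using * norm_ge_zero[of y] unfolding abs_norm_cancel by linarith
qed

lemma subgauss_power: "subgauss S f \<Longrightarrow> subgauss S (\<lambda>t y. f t y ^ n)"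
  by (induction n) (auto intro: subgauss_const subgauss_mult)

lemma subgauss_inner: "subgauss S (\<lambda>_ y. y \<bullet> e)"
  by (rule subgauss_mono[OF subgauss_mult[OF subgauss_norm subgauss_const[of _ "norm e"]]])
     (simp add: Cauchy_Schwarz_ineq2)

lemma norm_add_sq_le: "(norm (x + y :: 'a::real_normed_vector))\<^sup>2 \<le> 2 * (norm x)\<^sup>2 + 2 * (norm y)\<^sup>2"
proof -
  have "(norm (x + y))\<^sup>2 \<le> (norm x + norm y)\<^sup>2"
    by (intro power_mono norm_triangle_ineq) auto
  also have "\<dots> \<le> 2 * (norm x)\<^sup>2 + 2 * (norm y)\<^sup>2"
    using sum_squares_bound[of "norm x" "norm y"] by (simp add: power2_sum)
  finally show ?thesis .
qed

text \<open>Linear growth of the inner map only rescales the exponent, which the quantifier over all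
  exponents absorbs. It serves shifts, dilations and mean value points.\<close>

lemma subgauss_compose:
  fixes f :: "'k \<Rightarrow> 'a::real_normed_vector \<Rightarrow> real" and g :: "'k \<Rightarrow> 'b::real_normed_vector \<Rightarrow> 'a"
  assumes "subgauss S f" "\<And>t y. t \<in> S \<Longrightarrow> norm (g t y) \<le> L + K * norm y"
  shows "subgauss S (\<lambda>t y. f t (g t y))"
  unfolding subgauss_def
proof (intro allI impI)
  fix a :: real assume a: "a > 0"
  \<comment> \<open>Chosen so that \<open>b * (2 * (1 + K\<^sup>2)) = a\<close>: the 2 is the price
    of squaring a sum, and \<open>1 + K\<^sup>2\<close> keeps the denominator positive when
    \<open>K = 0\<close>.\<close>
  define b where "b = a / (2 * (1 + K\<^sup>2))"
  have K: "1 + K\<^sup>2 > 0" by (simp add: add_pos_nonneg)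
  have b: "b > 0" using a K by (simp add: b_def)
  obtain C where C: "C \<ge> 0" "\<And>t y. t \<in> S \<Longrightarrow> \<bar>f t y\<bar> \<le> C * exp (b * (norm y)\<^sup>2)"
    by (rule subgaussD[OF assms(1) b]) blast
  have "\<bar>f t (g t y)\<bar> \<le> (C * exp (2 * b * L\<^sup>2)) * exp (a * (norm y)\<^sup>2)" if "t \<in> S" for t y
  proof -
    have "(norm (g t y))\<^sup>2 \<le> (L + K * norm y)\<^sup>2"
      using assms(2)[OF that] by (intro power_mono) auto
    also have "\<dots> \<le> 2 * L\<^sup>2 + 2 * (K * norm y)\<^sup>2"
      using norm_add_sq_le[of L "K * norm y"] by simp
    also have "\<dots> \<le> 2 * L\<^sup>2 + 2 * (1 + K\<^sup>2) * (norm y)\<^sup>2"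
      by (simp add: power_mult_distrib algebra_simps)
    finally have "b * (norm (g t y))\<^sup>2 \<le> b * (2 * L\<^sup>2 + 2 * (1 + K\<^sup>2) * (norm y)\<^sup>2)"
      using b by simp
    also have "\<dots> = 2 * b * L\<^sup>2 + (b * (2 * (1 + K\<^sup>2))) * (norm y)\<^sup>2"
      by (simp add: algebra_simps)
    also have "b * (2 * (1 + K\<^sup>2)) = a" using K by (simp add: b_def)
    finally have *: "exp (b * (norm (g t y))\<^sup>2) \<le> exp (2 * b * L\<^sup>2) * exp (a * (norm y)\<^sup>2)"
      by (simp add: exp_add[symmetric])
    show ?thesis
      using C(2)[OF that, of "g t y"] mult_left_mono[OF * C(1)] by simp
  qed
  then show "\<exists>C. \<forall>t\<in>S. \<forall>y. \<bar>f t (g t y)\<bar> \<le> C * exp (a * (norm y)\<^sup>2)" by blast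
qed

lemma subgauss_bounded:
  assumes "\<And>t. t \<in> S \<Longrightarrow> \<bar>c t\<bar> \<le> K"
  shows "subgauss S (\<lambda>t _. c t)"
proof (rule subgauss_mono[OF subgauss_const[of S K]])
  fix t assume "t \<in> S"
  from assms[OF this] show "\<bar>c t\<bar> \<le> \<bar>K\<bar>" by linarith
qed

lemma subgauss_poly:
  fixes f :: "'k \<Rightarrow> 'a::real_normed_vector \<Rightarrow> real"
  assumes "c > 0" "\<And>t y. t \<in> S \<Longrightarrow> \<bar>f t y\<bar> \<le> c * (1 + norm y powr c)"
  shows "subgauss S f"
proof (rule subgauss_mono)
  define m where "m = nat \<lceil>c\<rceil>"
  show "subgauss S (\<lambda>_ y. c * (1 + (1 + norm y) ^ m))"
    by (intro subgauss_mult subgauss_add subgauss_const subgauss_power subgauss_norm)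
  fix t and y :: 'a assume t: "t \<in> S"
  \<comment> \<open>The base is raised to at least 1 so that the exponent can be rounded up to the
    natural number \<open>m\<close>.\<close>
  have "norm y powr c \<le> (1 + norm y) powr c"
    by (rule powr_mono2) (use assms in auto)
  also have "\<dots> \<le> (1 + norm y) powr (real m)"
    by (rule powr_mono) (auto simp: m_def intro: real_nat_ceiling_ge)
  also have "\<dots> = (1 + norm y) ^ m"
    by (rule powr_realpow) (simp add: add_pos_nonneg)
  finally have *: "norm y powr c \<le> (1 + norm y) ^ m" .
  have "\<bar>f t y\<bar> \<le> c * (1 + (1 + norm y) ^ m)"
    by (rule order_trans[OF assms(2)[OF t] mult_left_mono[OF add_left_mono[OF *]]])
      (use assms(1) in auto)
  then show "\<bar>f t y\<bar> \<le> \<bar>c * (1 + (1 + norm y) ^ m)\<bar>" by linarith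
qed

section \<open>Gaussian majorants and differentiation under the integral\<close>

text \<open>The function factorises over the coordinates, and each factor is a multiple of the
  normal density with variance \<open>1 / (2 * a)\<close>.\<close>

lemma integrable_gaussian:
  assumes "a > 0"
  shows "integrable lborel (\<lambda>y::'a::euclidean_space. exp (- a * (norm y)\<^sup>2))"
proof (rule integrableI_nonneg)
  have int1: "integrable lborel (\<lambda>x::real. exp (- a * x\<^sup>2))"
  proof -
    define \<sigma> where "\<sigma> = sqrt (1 / (2 * a))"
    have \<sigma>: "\<sigma>\<^sup>2 = 1 / (2 * a)" using assms by (simp add: \<sigma>_def)
    have \<sigma>0: "\<sigma> > 0" using assms by (simp add: \<sigma>_def)
    have "integrable lborel (\<lambda>x. sqrt (2 * pi * \<sigma>\<^sup>2) * normal_density 0 \<sigma> x)"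
      using \<sigma>0 by (intro integrable_mult_right integrable_normal_density)
    also have "(\<lambda>x. sqrt (2 * pi * \<sigma>\<^sup>2) * normal_density 0 \<sigma> x) = (\<lambda>x. exp (- a * x\<^sup>2))"
      unfolding normal_density_def \<sigma> using assms by (auto simp: field_simps)
    finally show ?thesis .
  qed
  have "(\<integral>\<^sup>+ (y::'a). ennreal (exp (- a * (norm y)\<^sup>2)) \<partial>lborel)
      = (\<integral>\<^sup>+ (y::'a). (\<Prod>b\<in>Basis. ennreal (exp (- a * (y \<bullet> b)\<^sup>2))) \<partial>lborel)"
  proof (intro nn_integral_cong)
    fix y :: 'a
    have "(norm y)\<^sup>2 = (\<Sum>b\<in>Basis. (y \<bullet> b)\<^sup>2)"
      by (simp add: euclidean_inner[of y y] power2_eq_square[symmetric] flip: dot_square_norm)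
    then show "ennreal (exp (- a * (norm y)\<^sup>2)) = (\<Prod>b\<in>Basis. ennreal (exp (- a * (y \<bullet> b)\<^sup>2)))"
      by (simp add: prod_ennreal exp_sum sum_distrib_left flip: sum_negf)
  qed
  also have "\<dots> = (\<Prod>b\<in>(Basis::'a set). \<integral>\<^sup>+ (x::real). ennreal (exp (- a * x\<^sup>2)) \<partial>lborel)"
    by (rule nn_integral_lborel_prod) auto
  also have "\<dots> < \<infinity>"
    using int1 unfolding integrable_iff_bounded by (auto simp: less_top[symmetric] power_eq_top_ennreal)
  finally show "(\<integral>\<^sup>+ (y::'a). ennreal (exp (- a * (norm y)\<^sup>2)) \<partial>lborel) < \<infinity>" .
qed auto

text \<open>Half of the rate \<open>a\<close> is spent on \<open>f\<close>; the other half survives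
  as an integrable majorant that is independent of \<open>t\<close>, although the rate of the weight
  may vary.\<close>

lemma subgauss_weighted_bound:
  fixes f :: "'k \<Rightarrow> 'a::euclidean_space \<Rightarrow> real"
  assumes "subgauss S f" "a > 0" "\<And>t. t \<in> S \<Longrightarrow> a \<le> \<alpha> t"
  obtains C where "\<And>t y. t \<in> S \<Longrightarrow> \<bar>f t y * exp (- \<alpha> t * (norm y)\<^sup>2)\<bar> \<le> C * exp (- (a / 2) * (norm y)\<^sup>2)"
proof -
  have "a / 2 > 0" using assms by simp
  then obtain C where C: "C \<ge> 0" "\<And>t y. t \<in> S \<Longrightarrow> \<bar>f t y\<bar> \<le> C * exp (a / 2 * (norm y)\<^sup>2)"
    by (rule subgaussD[OF assms(1)]) blast
  have "\<bar>f t y * exp (- \<alpha> t * (norm y)\<^sup>2)\<bar> \<le> C * exp (- (a / 2) * (norm y)\<^sup>2)" if t: "t \<in> S" for t y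
  proof -
    have "- \<alpha> t * (norm y)\<^sup>2 \<le> - a * (norm y)\<^sup>2"
      using assms(3)[OF t] by (intro mult_right_mono) auto
    then have "\<bar>f t y * exp (- \<alpha> t * (norm y)\<^sup>2)\<bar> \<le> C * exp (a / 2 * (norm y)\<^sup>2) * exp (- a * (norm y)\<^sup>2)"
      unfolding abs_mult using C t by (intro mult_mono) auto
    also have "\<dots> = C * exp (- (a / 2) * (norm y)\<^sup>2)"
      by (simp add: field_simps flip: exp_add)
    finally show ?thesis .
  qed
  then show ?thesis by (rule that)
qed

lemma integrable_subgauss_gaussian:
  fixes f :: "'a::euclidean_space \<Rightarrow> real"
  assumes "subgauss {()} (\<lambda>_. f)" "f \<in> borel_measurable borel" "a > 0"
  shows "integrable lborel (\<lambda>y. f y * exp (- a * (norm y)\<^sup>2))"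
proof -
  obtain C where C: "\<And>y. \<bar>f y * exp (- a * (norm y)\<^sup>2)\<bar> \<le> C * exp (- (a / 2) * (norm y)\<^sup>2)"
    using subgauss_weighted_bound[OF assms(1,3), of "\<lambda>_. a"] by auto
  show ?thesis
  proof (rule Bochner_Integration.integrable_bound)
    show "integrable lborel (\<lambda>y::'a. C * exp (- (a / 2) * (norm y)\<^sup>2))"
      using assms(3) by (intro integrable_mult_right integrable_gaussian) auto
    show "(\<lambda>y. f y * exp (- a * (norm y)\<^sup>2)) \<in> borel_measurable lborel" using assms(2) by measurable
    show "AE y in lborel. norm (f y * exp (- a * (norm y)\<^sup>2)) \<le> norm (C * exp (- (a / 2) * (norm y)\<^sup>2))"
      using C by (intro AE_I2) (auto intro: order_trans[OF _ abs_ge_self])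
  qed
qed

text \<open>The mean value inequality on the convex set \<open>S\<close> bounds the difference
  quotients by \<open>W\<close>, so dominated convergence applies along every sequence. Working
  within \<open>S\<close> covers the one-sided derivatives at the ends of a time interval.\<close>

lemma has_real_derivative_integral:
  fixes F F' :: "real \<Rightarrow> 'b \<Rightarrow> real"
  assumes "convex S" "t \<in> S"
    and der: "\<And>s y. s \<in> S \<Longrightarrow> ((\<lambda>s. F s y) has_real_derivative F' s y) (at s within S)"
    and bound: "\<And>s y. s \<in> S \<Longrightarrow> \<bar>F' s y\<bar> \<le> W y"
    and W: "integrable M W" and int: "\<And>s. s \<in> S \<Longrightarrow> integrable M (F s)"
    and meas: "F' t \<in> borel_measurable M"
  shows "((\<lambda>s. \<integral>y. F s y \<partial>M) has_real_derivative (\<integral>y. F' t y \<partial>M)) (at t within S)"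
  unfolding has_field_derivative_iff tendsto_at_iff_sequentially
proof (intro allI impI)
  fix X :: "nat \<Rightarrow> real"
  assume X: "\<forall>i. X i \<in> S - {t}" and lim: "X \<longlonglongrightarrow> t"
  have eq: "((\<lambda>s. ((\<integral>y. F s y \<partial>M) - (\<integral>y. F t y \<partial>M)) / (s - t)) \<circ> X)
      = (\<lambda>i. \<integral>y. (F (X i) y - F t y) / (X i - t) \<partial>M)"
    using X assms(2) int by (auto simp: fun_eq_iff)
  show "((\<lambda>s. ((\<integral>y. F s y \<partial>M) - (\<integral>y. F t y \<partial>M)) / (s - t)) \<circ> X)
      \<longlonglongrightarrow> (\<integral>y. F' t y \<partial>M)"
    unfolding eq
  proof (rule integral_dominated_convergence[where w = W])
    show "(\<lambda>y. (F (X i) y - F t y) / (X i - t)) \<in> borel_measurable M" for i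
      using X assms(2) int[THEN borel_measurable_integrable] by (auto intro!: borel_measurable_divide borel_measurable_diff)
    show "AE y in M. (\<lambda>i. (F (X i) y - F t y) / (X i - t)) \<longlonglongrightarrow> F' t y"
    proof (rule AE_I2)
      fix y
      have "((\<lambda>s. (F s y - F t y) / (s - t)) \<longlongrightarrow> F' t y) (at t within S)"
        using der[OF assms(2), of y] by (simp add: has_field_derivative_iff)
      then have "((\<lambda>s. (F s y - F t y) / (s - t)) \<circ> X) \<longlonglongrightarrow> F' t y"
        using X lim unfolding tendsto_at_iff_sequentially by blast
      then show "(\<lambda>i. (F (X i) y - F t y) / (X i - t)) \<longlonglongrightarrow> F' t y" by (simp add: o_def)
    qed
    show "AE y in M. norm ((F (X i) y - F t y) / (X i - t)) \<le> W y" for i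
    proof (rule AE_I2)
      fix y
      have "norm (F (X i) y - F t y) \<le> W y * norm (X i - t)"
        using X assms(2) bound by (intro field_differentiable_bound[OF assms(1), of "\<lambda>s. F s y", OF der]) auto
      then show "norm ((F (X i) y - F t y) / (X i - t)) \<le> W y"
        using X by (simp add: field_simps)
    qed
  qed (use W meas in auto)
qed

section \<open>Gaussian integration by parts, and growth from partial derivatives\<close>

lemma lborel_integral_translate:
  fixes f :: "'a::euclidean_space \<Rightarrow> real"
  assumes [measurable]: "f \<in> borel_measurable borel"
  shows "(\<integral>y. f (c + y) \<partial>lborel) = (\<integral>y. f y \<partial>lborel)"
proof -
  have "(\<integral>y. f y \<partial>lborel) = (\<integral>y. f y \<partial>distr lborel borel ((+) c))" by (simp add: lborel_distr_plus)
  also have "\<dots> = (\<integral>y. f (c + y) \<partial>lborel)" by (rule integral_distr) auto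
  finally show ?thesis by simp
qed

lemma lborel_integral_scale:
  fixes f :: "'a::euclidean_space \<Rightarrow> real"
  assumes [measurable]: "f \<in> borel_measurable borel" and "s > 0"
  shows "(\<integral>y. f y \<partial>lborel) = s ^ DIM('a) * (\<integral>y. f (s *\<^sub>R y) \<partial>lborel)"
proof -
  have "(\<integral>y. f y \<partial>lborel)
      = (\<integral>y. f y \<partial>density (distr lborel borel (\<lambda>x::'a. 0 + s *\<^sub>R x)) (\<lambda>_. ennreal (\<bar>s\<bar> ^ DIM('a))))"
    using assms by (subst lborel_affine[of s 0]) auto
  also have "\<dots> = (\<integral>y. \<bar>s\<bar> ^ DIM('a) *\<^sub>R f y \<partial>distr lborel borel (\<lambda>x::'a. 0 + s *\<^sub>R x))"
    by (rule integral_density) auto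
  also have "\<dots> = (\<integral>y. \<bar>s\<bar> ^ DIM('a) *\<^sub>R f (0 + s *\<^sub>R y) \<partial>lborel)"
    by (rule integral_distr) auto
  also have "\<dots> = s ^ DIM('a) * (\<integral>y. f (s *\<^sub>R y) \<partial>lborel)"
    using assms(2) by simp
  finally show ?thesis .
qed

text \<open>Differentiate the translation-invariant integral of \<open>f\<close> times the Gaussian in direction \<open>e\<close>.\<close>

lemma gaussian_by_parts:
  fixes f f' :: "'a::euclidean_space \<Rightarrow> real"
  assumes a: "a > 0"
    and der: "\<And>y. ((\<lambda>h. f (y + h *\<^sub>R e)) has_real_derivative f' y) (at 0)"
    and sg: "subgauss {()} (\<lambda>_. f)" "subgauss {()} (\<lambda>_. f')"
    and [measurable]: "f \<in> borel_measurable borel" "f' \<in> borel_measurable borel"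
  shows "(\<integral>y. f' y * exp (- a * (norm y)\<^sup>2) \<partial>lborel)
       = (\<integral>y. 2 * a * (y \<bullet> e) * f y * exp (- a * (norm y)\<^sup>2) \<partial>lborel)"
proof -
  \<comment> \<open>\<open>q * g\<close> is the derivative of \<open>f * g\<close> in direction
    \<open>e\<close>.\<close>
  define q where "q y = f' y + (- 2 * a) * ((y \<bullet> e) * f y)" for y
  define g where "g y = exp (- a * (norm y)\<^sup>2)" for y :: 'a
  have sgq: "subgauss {()} (\<lambda>_. q)"
    unfolding q_def by (intro subgauss_add subgauss_mult subgauss_const subgauss_inner sg)
  have qm[measurable]: "q \<in> borel_measurable borel" and [measurable]: "g \<in> borel_measurable borel"
    unfolding q_def g_def by measurable
  have dG: "((\<lambda>h. f (y + h *\<^sub>R e) * g (y + h *\<^sub>R e)) has_real_derivative q (y + h *\<^sub>R e) * g (y + h *\<^sub>R e)) (at h)"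
    for y h
  proof -
    \<comment> \<open>The hypothesis differentiates at parameter 0 only, but at every base point;
      moving the base point yields the derivative at every \<open>h\<close>.\<close>
    have "((\<lambda>k. f ((y + h *\<^sub>R e) + k *\<^sub>R e)) has_real_derivative f' (y + h *\<^sub>R e)) (at 0)" by (rule der)
    then have f: "((\<lambda>k. f (y + k *\<^sub>R e)) has_real_derivative f' (y + h *\<^sub>R e)) (at h)"
      using DERIV_shift[of "\<lambda>k. f (y + k *\<^sub>R e)" "f' (y + h *\<^sub>R e)" 0 h]
      by (simp add: algebra_simps)
    have g: "((\<lambda>k. g (y + k *\<^sub>R e)) has_real_derivative
        g (y + h *\<^sub>R e) * (- a * (2 * ((y + h *\<^sub>R e) \<bullet> e)))) (at h)"
      unfolding g_def power2_norm_eq_inner inner_add_left inner_add_right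
      by (auto intro!: derivative_eq_intros simp: inner_commute algebra_simps)
    show ?thesis
      by (rule DERIV_cong[OF DERIV_mult[OF f g]]) (simp add: q_def algebra_simps)
  qed
  obtain C where C: "\<And>y. \<bar>q y * g y\<bar> \<le> C * exp (- (a / 2) * (norm y)\<^sup>2)"
    using subgauss_weighted_bound[OF sgq a, of "\<lambda>_. a"] unfolding g_def by auto
  have C0: "C \<ge> 0" using order_trans[OF abs_ge_zero C[of 0]] by simp
  \<comment> \<open>For \<open>h\<close> in \<open>{-1..1}\<close> the square of
    \<open>norm y\<close> is at most twice that of \<open>norm (y + h *\<^sub>R e)\<close> plus
    twice that of \<open>norm e\<close>. So rate \<open>a / 2\<close> at the shifted point leaves
    rate \<open>a / 4\<close> at \<open>y\<close>, with the factor
    \<open>exp (a / 2 * (norm e)\<^sup>2)\<close>.\<close>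
  define W where "W y = C * exp (a / 2 * (norm e)\<^sup>2) * exp (- (a / 4) * (norm y)\<^sup>2)" for y :: 'a
  have bound: "\<bar>q (y + h *\<^sub>R e) * g (y + h *\<^sub>R e)\<bar> \<le> W y" if h: "h \<in> {-1..1}" for y h
  proof -
    have h1: "h\<^sup>2 \<le> 1" using h abs_le_square_iff[of h 1] by auto
    have "(norm y)\<^sup>2 \<le> 2 * (norm (y + h *\<^sub>R e))\<^sup>2 + 2 * (norm (- h *\<^sub>R e))\<^sup>2"
      using norm_add_sq_le[of "y + h *\<^sub>R e" "- h *\<^sub>R e"] by simp
    also have "\<dots> \<le> 2 * (norm (y + h *\<^sub>R e))\<^sup>2 + 2 * (norm e)\<^sup>2"
      using mult_right_mono[OF h1, of "(norm e)\<^sup>2"] by (simp add: power_mult_distrib)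
    finally have "(a / 4) * (norm y)\<^sup>2 \<le> (a / 4) * (2 * (norm (y + h *\<^sub>R e))\<^sup>2 + 2 * (norm e)\<^sup>2)"
      using a by (intro mult_left_mono) auto
    then have "- (a / 2) * (norm (y + h *\<^sub>R e))\<^sup>2 \<le> a / 2 * (norm e)\<^sup>2 + - (a / 4) * (norm y)\<^sup>2"
      by (simp add: algebra_simps)
    then have "exp (- (a / 2) * (norm (y + h *\<^sub>R e))\<^sup>2) \<le> exp (a / 2 * (norm e)\<^sup>2) * exp (- (a / 4) * (norm y)\<^sup>2)"
      unfolding exp_add[symmetric] by simp
    from mult_left_mono[OF this C0] C[of "y + h *\<^sub>R e"] show ?thesis
      unfolding W_def by (simp add: mult.assoc)
  qed
  have intf: "integrable lborel (\<lambda>y. f y * g y)"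
    unfolding g_def by (rule integrable_subgauss_gaussian) (use sg a in auto)
  have trans: "(\<integral>y. f (y + h *\<^sub>R e) * g (y + h *\<^sub>R e) \<partial>lborel) = (\<integral>y. f y * g y \<partial>lborel)" for h
    using lborel_integral_translate[of "\<lambda>y. f y * g y" "h *\<^sub>R e"] by (simp add: add.commute)
  have inth: "integrable lborel (\<lambda>y. f (y + h *\<^sub>R e) * g (y + h *\<^sub>R e))" for h
  proof -
    have "integrable (distr lborel borel ((+) (h *\<^sub>R e))) (\<lambda>y. f y * g y)"
      using intf by (simp add: lborel_distr_plus)
    then have "integrable lborel (\<lambda>y. f (h *\<^sub>R e + y) * g (h *\<^sub>R e + y))"
      by (subst (asm) integrable_distr_eq) auto
    then show ?thesis by (simp add: add.commute)
  qed
  have "((\<lambda>h. \<integral>y. f (y + h *\<^sub>R e) * g (y + h *\<^sub>R e) \<partial>lborel) has_real_derivative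
      (\<integral>y. q (y + 0 *\<^sub>R e) * g (y + 0 *\<^sub>R e) \<partial>lborel)) (at 0 within {-1..1})"
  proof (rule has_real_derivative_integral[where W = W])
    show "integrable lborel W" unfolding W_def
      using a by (intro integrable_mult_right integrable_gaussian) auto
  qed (auto intro: DERIV_subset[OF dG] bound inth)
  \<comment> \<open>By \<open>trans\<close> the differentiated function is constant in
    \<open>h\<close>; 0 is interior to \<open>{-1..1}\<close>, so the two-sided derivative is
    available and must vanish.\<close>
  then have "((\<lambda>h::real. \<integral>y. f y * g y \<partial>lborel) has_real_derivative (\<integral>y. q y * g y \<partial>lborel)) (at 0)"
    unfolding trans by (subst (asm) at_within_interior) auto
  then have 0: "(\<integral>y. q y * g y \<partial>lborel) = 0"
    using DERIV_unique DERIV_const by blast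
  have i1: "integrable lborel (\<lambda>y. f' y * g y)"
    unfolding g_def by (rule integrable_subgauss_gaussian) (use sg a in auto)
  have i2: "integrable lborel (\<lambda>y. (2 * a * ((y \<bullet> e) * f y)) * g y)"
    unfolding g_def
    by (rule integrable_subgauss_gaussian) (use sg a in \<open>auto intro!: subgauss_mult subgauss_const subgauss_inner\<close>)
  have "(\<integral>y. q y * g y \<partial>lborel) = (\<integral>y. f' y * g y - (2 * a * ((y \<bullet> e) * f y)) * g y \<partial>lborel)"
    by (intro Bochner_Integration.integral_cong) (auto simp: q_def algebra_simps)
  also have "\<dots> = (\<integral>y. f' y * g y \<partial>lborel) - (\<integral>y. (2 * a * ((y \<bullet> e) * f y)) * g y \<partial>lborel)"
    by (rule Bochner_Integration.integral_diff[OF i1 i2])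
  finally show ?thesis using 0 by (simp add: g_def mult.assoc)
qed

text \<open>The path from 0 to \<open>x\<close> switches on one coordinate at a time. On each
  axis-parallel segment the one-dimensional mean value theorem expresses the increment through a
  partial derivative, whose growth is known.\<close>

lemma subgauss_from_partials:
  fixes w :: "'k \<Rightarrow> 'a::euclidean_space \<Rightarrow> real"
  assumes der: "\<And>t y b. t \<in> S \<Longrightarrow> b \<in> Basis \<Longrightarrow> ((\<lambda>h. w t (y + h *\<^sub>R b)) has_real_derivative D b t y) (at 0)"
    and sgD: "\<And>b. b \<in> Basis \<Longrightarrow> subgauss S (D b)"
    and bdd: "\<And>t. t \<in> S \<Longrightarrow> \<bar>w t 0\<bar> \<le> K"
  shows "subgauss S w"
proof -
  have "subgauss S (\<lambda>t x. w t (\<Sum>b\<in>I. (x \<bullet> b) *\<^sub>R b))" if "finite I" "I \<subseteq> Basis" for I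
    using that
  proof (induction I rule: finite_induct)
    case empty
    have "subgauss S (\<lambda>t (x::'a). w t 0)" using bdd by (rule subgauss_bounded)
    then show ?case by simp
  next
    case (insert b I)
    define p where "p x = (\<Sum>c\<in>I. (x \<bullet> c) *\<^sub>R c)" for x :: 'a
    have b: "b \<in> Basis" using insert by auto
    have derh: "((\<lambda>k. w t (p x + k *\<^sub>R b)) has_real_derivative D b t (p x + h *\<^sub>R b)) (at h)" if "t \<in> S" for t x h
    proof -
      have "((\<lambda>k. w t ((p x + h *\<^sub>R b) + k *\<^sub>R b)) has_real_derivative D b t (p x + h *\<^sub>R b)) (at 0)"
        using that b by (rule der)
      then show ?thesis
        using DERIV_shift[of "\<lambda>k. w t (p x + k *\<^sub>R b)" "D b t (p x + h *\<^sub>R b)" 0 h]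
        by (simp add: algebra_simps)
    qed
    have "\<exists>k. \<bar>k\<bar> \<le> \<bar>x \<bullet> b\<bar> \<and> w t (p x + (x \<bullet> b) *\<^sub>R b) - w t (p x) = (x \<bullet> b) * D b t (p x + k *\<^sub>R b)"
      if t: "t \<in> S" for t x
    proof -
      consider "x \<bullet> b = 0" | "x \<bullet> b > 0" | "x \<bullet> b < 0" by linarith
      then show ?thesis
      proof cases
        case 1
        then show ?thesis by auto
      next
        case 2
        obtain z where "0 < z" "z < x \<bullet> b"
          "w t (p x + (x \<bullet> b) *\<^sub>R b) - w t (p x + 0 *\<^sub>R b) = (x \<bullet> b - 0) * D b t (p x + z *\<^sub>R b)"
          using MVT2[OF 2 derh[OF t, of x]] by blast
        then show ?thesis by (intro exI[of _ z]) auto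
      next
        case 3
        obtain z where "x \<bullet> b < z" "z < 0"
          "w t (p x + 0 *\<^sub>R b) - w t (p x + (x \<bullet> b) *\<^sub>R b) = (0 - x \<bullet> b) * D b t (p x + z *\<^sub>R b)"
          using MVT2[OF 3 derh[OF t, of x]] by blast
        then show ?thesis by (intro exI[of _ z]) auto
      qed
    qed
    \<comment> \<open>The mean value point is merely chosen for each \<open>t\<close> and
      \<open>x\<close>; only its size enters, through \<open>subgauss_compose\<close>.\<close>
    then obtain k where k: "\<And>t x. t \<in> S \<Longrightarrow> \<bar>k t x\<bar> \<le> \<bar>x \<bullet> b\<bar>"
      "\<And>t x. t \<in> S \<Longrightarrow> w t (p x + (x \<bullet> b) *\<^sub>R b) - w t (p x) = (x \<bullet> b) * D b t (p x + k t x *\<^sub>R b)"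
      by metis
    \<comment> \<open>Crude count: each of the \<open>card I\<close> terms of \<open>p x\<close> has
      norm at most \<open>norm x\<close>, and the mean value point adds one more.\<close>
    have normp: "norm (p x + k t x *\<^sub>R b) \<le> 0 + (real (card I) + 1) * norm x" if t: "t \<in> S" for t x
    proof -
      have "norm (p x) \<le> real (card I) * norm x" unfolding p_def
      proof (rule sum_norm_bound)
        fix c assume "c \<in> I"
        then have "c \<in> Basis" using insert by auto
        then show "norm ((x \<bullet> c) *\<^sub>R c) \<le> norm x" using Basis_le_norm by simp
      qed
      moreover have "norm (k t x *\<^sub>R b) \<le> norm x"
        using k(1)[OF t, of x] Basis_le_norm[OF b, of x] b by simp
      ultimately show ?thesis using norm_triangle_ineq[of "p x" "k t x *\<^sub>R b"]
        by (simp add: algebra_simps)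
    qed
    have "subgauss S (\<lambda>t x. w t (p x))" using insert unfolding p_def by auto
    moreover have "subgauss S (\<lambda>t x. (x \<bullet> b) * D b t (p x + k t x *\<^sub>R b))"
      by (rule subgauss_mult[OF subgauss_inner subgauss_compose[OF sgD[OF b] normp]])
    ultimately have "subgauss S (\<lambda>t x. w t (p x) + (x \<bullet> b) * D b t (p x + k t x *\<^sub>R b))"
      by (rule subgauss_add)
    then show ?case
    proof (rule subgauss_mono)
      fix t x assume t: "t \<in> S"
      have "(\<Sum>c\<in>insert b I. (x \<bullet> c) *\<^sub>R c) = p x + (x \<bullet> b) *\<^sub>R b"
        using insert by (simp add: p_def add.commute)
      then show "\<bar>w t (\<Sum>c\<in>insert b I. (x \<bullet> c) *\<^sub>R c)\<bar> \<le> \<bar>w t (p x) + (x \<bullet> b) * D b t (p x + k t x *\<^sub>R b)\<bar>"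
        using k(2)[OF t, of x] by simp
    qed
  qed
  from this[of Basis] show ?thesis by (simp add: euclidean_representation)
qed

text \<open>The factor on the right is the Laplacian of \<open>exp (- a * (norm y)\<^sup>2)\<close>
  divided by that function. It arises from two integrations by parts per coordinate, summed over the
  basis.\<close>

lemma gaussian_laplacian:
  fixes f :: "'a::euclidean_space \<Rightarrow> real"
  assumes a: "a > 0"
    and dx: "\<And>y b. b \<in> Basis \<Longrightarrow> ((\<lambda>h. f (y + h *\<^sub>R b)) has_real_derivative D b y) (at 0)"
    and dxx: "\<And>y b. b \<in> Basis \<Longrightarrow> ((\<lambda>h. D b (y + h *\<^sub>R b)) has_real_derivative DD b y) (at 0)"
    and sg: "subgauss {()} (\<lambda>_. f)" "\<And>b. b \<in> Basis \<Longrightarrow> subgauss {()} (\<lambda>_. D b)"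
      "\<And>b. b \<in> Basis \<Longrightarrow> subgauss {()} (\<lambda>_. DD b)"
    and m[measurable]: "f \<in> borel_measurable borel" "\<And>b. b \<in> Basis \<Longrightarrow> D b \<in> borel_measurable borel"
      "\<And>b. b \<in> Basis \<Longrightarrow> DD b \<in> borel_measurable borel"
  shows "(\<integral>y. (\<Sum>b\<in>Basis. DD b y) * exp (- a * (norm y)\<^sup>2) \<partial>lborel)
       = (\<integral>y. 2 * a * (2 * a * (norm y)\<^sup>2 - DIM('a)) * f y * exp (- a * (norm y)\<^sup>2) \<partial>lborel)"
proof -
  define g where "g y = exp (- a * (norm y)\<^sup>2)" for y :: 'a
  have int: "integrable lborel (\<lambda>y. h y * g y)" if "subgauss {()} (\<lambda>_. h)" "h \<in> borel_measurable borel" for h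
    unfolding g_def using that a by (rule integrable_subgauss_gaussian)
  have one: "(\<integral>y. DD b y * g y \<partial>lborel) = (\<integral>y. 2 * a * (2 * a * (y \<bullet> b)\<^sup>2 - 1) * f y * g y \<partial>lborel)"
    if b: "b \<in> Basis" for b
  proof -
    note [measurable] = m(2)[OF b] m(3)[OF b]
    have "(\<integral>y. DD b y * g y \<partial>lborel) = (\<integral>y. 2 * a * (y \<bullet> b) * D b y * g y \<partial>lborel)"
      unfolding g_def by (rule gaussian_by_parts[OF a dxx[OF b] sg(2)[OF b] sg(3)[OF b]]) (use b in auto)
    also have "\<dots> = 2 * a * (\<integral>y. ((y \<bullet> b) * D b y) * g y \<partial>lborel)"
      by (simp add: mult.assoc)
    \<comment> \<open>Adding and subtracting \<open>f y\<close> completes the integrand to the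
      derivative of \<open>(y \<bullet> b) * f y\<close> along \<open>b\<close>, ready for the
      second integration by parts.\<close>
    also have "(\<integral>y. ((y \<bullet> b) * D b y) * g y \<partial>lborel)
        = (\<integral>y. (f y + (y \<bullet> b) * D b y) * g y - f y * g y \<partial>lborel)"
      by (intro Bochner_Integration.integral_cong) (auto simp: algebra_simps)
    also have "\<dots> = (\<integral>y. (f y + (y \<bullet> b) * D b y) * g y \<partial>lborel) - (\<integral>y. f y * g y \<partial>lborel)"
      by (intro Bochner_Integration.integral_diff int subgauss_add subgauss_mult subgauss_inner sg b) auto
    also have "(\<integral>y. (f y + (y \<bullet> b) * D b y) * g y \<partial>lborel)
        = (\<integral>y. 2 * a * (y \<bullet> b) * ((y \<bullet> b) * f y) * g y \<partial>lborel)"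
      unfolding g_def
    proof (rule gaussian_by_parts[OF a])
      show "((\<lambda>h. ((y + h *\<^sub>R b) \<bullet> b) * f (y + h *\<^sub>R b)) has_real_derivative f y + (y \<bullet> b) * D b y) (at 0)" for y
        using b by (auto intro!: derivative_eq_intros dx simp: inner_add_left)
    qed (use b in \<open>auto intro!: subgauss_add subgauss_mult subgauss_inner sg\<close>)
    also have "(\<integral>y. 2 * a * (y \<bullet> b) * ((y \<bullet> b) * f y) * g y \<partial>lborel)
        = (\<integral>y. (2 * a * ((y \<bullet> b) * ((y \<bullet> b) * f y))) * g y \<partial>lborel)"
      by (simp only: mult.assoc)
    also have "\<dots> - (\<integral>y. f y * g y \<partial>lborel)
        = (\<integral>y. (2 * a * ((y \<bullet> b) * ((y \<bullet> b) * f y))) * g y - f y * g y \<partial>lborel)"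
      by (intro Bochner_Integration.integral_diff[symmetric] int subgauss_mult subgauss_const subgauss_inner sg) auto
    also have "2 * a * \<dots> = (\<integral>y. 2 * a * ((2 * a * ((y \<bullet> b) * ((y \<bullet> b) * f y))) * g y - f y * g y) \<partial>lborel)"
      by (rule Bochner_Integration.integral_mult_right_zero[symmetric])
    also have "\<dots> = (\<integral>y. 2 * a * (2 * a * (y \<bullet> b)\<^sup>2 - 1) * f y * g y \<partial>lborel)"
      by (intro Bochner_Integration.integral_cong) (auto simp: algebra_simps power2_eq_square)
    finally show ?thesis .
  qed
  have "(\<integral>y. (\<Sum>b\<in>Basis. DD b y) * g y \<partial>lborel) = (\<Sum>b\<in>Basis. \<integral>y. DD b y * g y \<partial>lborel)"
    unfolding sum_distrib_right by (intro Bochner_Integration.integral_sum int sg m)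
  \<comment> \<open>Written with \<open>+ -1\<close> so that the closure rules for sums and products
    apply literally.\<close>
  also have "\<dots> = (\<Sum>b\<in>Basis. \<integral>y. (2 * a * ((2 * a * (y \<bullet> b)^2 + -1) * f y)) * g y \<partial>lborel)"
    using one by (intro sum.cong) (auto simp: mult.assoc)
  also have "\<dots> = (\<integral>y. (\<Sum>b\<in>Basis. (2 * a * ((2 * a * (y \<bullet> b)^2 + -1) * f y)) * g y) \<partial>lborel)"
    by (intro Bochner_Integration.integral_sum[symmetric] int subgauss_mult subgauss_add subgauss_const
        subgauss_power subgauss_inner sg) measurable
  also have "\<dots> = (\<integral>y. 2 * a * (2 * a * (norm y)\<^sup>2 - DIM('a)) * f y * g y \<partial>lborel)"
  proof (intro Bochner_Integration.integral_cong refl)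
    fix y :: 'a
    have n: "(\<Sum>b\<in>Basis. (y \<bullet> b)\<^sup>2) = (norm y)\<^sup>2"
      by (simp add: euclidean_inner[of y y] power2_eq_square[symmetric] flip: dot_square_norm)
    have "(\<Sum>b\<in>Basis. (2 * a * ((2 * a * (y \<bullet> b)^2 + -1) * f y)) * g y)
        = 2 * a * ((\<Sum>b\<in>(Basis::'a set). 2 * a * (y \<bullet> b)^2 + -1) * f y) * g y"
      by (simp only: sum_distrib_left sum_distrib_right)
    also have "(\<Sum>b\<in>(Basis::'a set). 2 * a * (y \<bullet> b)^2 + -1) = 2 * a * (norm y)\<^sup>2 - DIM('a)"
      unfolding sum.distrib n[symmetric] sum_distrib_left by simp
    finally show "(\<Sum>b\<in>Basis. (2 * a * ((2 * a * (y \<bullet> b)^2 + -1) * f y)) * g y)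
        = 2 * a * (2 * a * (norm y)\<^sup>2 - DIM('a)) * f y * g y"
      by (simp only: mult.assoc)
  qed
  finally show ?thesis unfolding g_def .
qed

section \<open>Constancy of the Gaussian mean along the heat flow\<close>

text \<open>The unnormalised integral \<open>I\<close> and the power \<open>\<sigma> t ^ n\<close>
  satisfy the same linear differential equation on \<open>[0, T)\<close>, so their quotient
  \<open>H\<close> is constant there. Its value at 0 is the left side, its limit at \<open>T\<close>
  the right side.\<close>

lemma heat_gaussian_mean:
  fixes w w' :: "real \<Rightarrow> 'a::euclidean_space \<Rightarrow> real" and D DD :: "'a \<Rightarrow> real \<Rightarrow> 'a \<Rightarrow> real"
  assumes T: "T > 0" and rho: "\<rho> > 0"
    and cont: "continuous_on ({0..T} \<times> UNIV) (\<lambda>(t, y). w t y)"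
    and dt: "\<And>t y. t \<in> {0..T} \<Longrightarrow> ((\<lambda>s. w s y) has_real_derivative w' t y) (at t within {0..T})"
    and dx: "\<And>t y b. t \<in> {0..T} \<Longrightarrow> b \<in> Basis \<Longrightarrow>
      ((\<lambda>h. w t (y + h *\<^sub>R b)) has_real_derivative D b t y) (at 0)"
    and dxx: "\<And>t y b. t \<in> {0..T} \<Longrightarrow> b \<in> Basis \<Longrightarrow>
      ((\<lambda>h. D b t (y + h *\<^sub>R b)) has_real_derivative DD b t y) (at 0)"
    and mw': "\<And>t. t \<in> {0..T} \<Longrightarrow> w' t \<in> borel_measurable borel"
    and mD: "\<And>t b. t \<in> {0..T} \<Longrightarrow> b \<in> Basis \<Longrightarrow> D b t \<in> borel_measurable borel"
      "\<And>t b. t \<in> {0..T} \<Longrightarrow> b \<in> Basis \<Longrightarrow> DD b t \<in> borel_measurable borel"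
    and sg: "subgauss {0..T} w" "subgauss {0..T} w'"
      "\<And>b. b \<in> Basis \<Longrightarrow> subgauss {0..T} (D b)" "\<And>b. b \<in> Basis \<Longrightarrow> subgauss {0..T} (DD b)"
    and heat: "\<And>t y. t \<in> {0..T} \<Longrightarrow> w' t y = \<rho> * (\<Sum>b\<in>Basis. DD b t y)"
  shows "(\<integral>z. w 0 (sqrt (2 * T * \<rho>) *\<^sub>R z) * exp (- (1 / 2) * (norm z)\<^sup>2) \<partial>lborel)
       = w T 0 * (\<integral>(z::'a). exp (- (1 / 2) * (norm z)\<^sup>2) \<partial>lborel)"
proof -
  define n where "n = DIM('a)"
  define \<sigma> where "\<sigma> t = sqrt (2 * \<rho> * (T - t))" for t
  \<comment> \<open>This is \<open>1 / (2 * (\<sigma> t)\<^sup>2)\<close> for \<open>t < T\<close>.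
    Division by zero gives \<open>\<alpha> T = 0\<close>, so \<open>I\<close> carries meaning only
    before \<open>T\<close>, whereas \<open>H\<close> is built from \<open>\<sigma>\<close>, which
    is continuous up to \<open>T\<close>.\<close>
  define \<alpha> where "\<alpha> t = 1 / (4 * \<rho> * (T - t))" for t
  define I where "I t = (\<integral>y. w t y * exp (- \<alpha> t * (norm y)\<^sup>2) \<partial>lborel)" for t
  define H where "H t = (\<integral>z. w t (\<sigma> t *\<^sub>R z) * exp (- (1 / 2) * (norm z)\<^sup>2) \<partial>lborel)" for t
  have mw[measurable]: "w t \<in> borel_measurable borel" if "t \<in> {0..T}" for t
  proof (rule borel_measurable_continuous_onI)
    have "continuous_on UNIV (\<lambda>y. (\<lambda>(t, y). w t y) (t, y))"
      by (rule continuous_on_compose2[OF cont]) (use that in \<open>auto intro!: continuous_intros\<close>)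
    then show "continuous_on UNIV (w t)" by simp
  qed
  have sg1: "subgauss {()} (\<lambda>_. f t)" if "subgauss {0..T} f" "t \<in> {0..T}" for f :: "real \<Rightarrow> 'a \<Rightarrow> real" and t
    using subgauss_at[OF that] .
  have \<sigma>: "\<sigma> t > 0" "(\<sigma> t)\<^sup>2 = 2 * \<rho> * (T - t)" "\<alpha> t > 0" if "t < T" for t
    using that rho by (auto simp: \<sigma>_def \<alpha>_def)
  have I': "(I has_real_derivative (- (n * \<rho> / (\<sigma> t)\<^sup>2) * I t)) (at t within {0..b})"
    if b: "b < T" and t: "t \<in> {0..b}" for b t
  proof -
    \<comment> \<open>The derivative of \<open>\<alpha>\<close>. On \<open>{0..b}\<close> with
      \<open>b < T\<close> it is bounded by \<open>c b\<close>, while \<open>\<alpha>\<close> stays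
      above \<open>\<alpha> 0\<close>, the rate used for the majorant.\<close>
    define c where "c s = 4 * \<rho> * (\<alpha> s)\<^sup>2" for s
    have sub: "{0..b} \<subseteq> {0..T}" using b by auto
    have tT: "t \<in> {0..T}" "t < T" using b t by auto
    note [measurable] = mw[OF tT(1)] mw'[OF tT(1)]
    have \<alpha>: "\<alpha> 0 \<le> \<alpha> s" "\<alpha> s \<le> \<alpha> b" "0 < \<alpha> s" if "s \<in> {0..b}" for s
      using that b rho T unfolding \<alpha>_def by (auto intro!: divide_left_mono mult_left_mono mult_pos_pos)
    have d\<alpha>: "(\<alpha> has_real_derivative c s) (at s within {0..b})" if "s \<in> {0..b}" for s
      unfolding \<alpha>_def c_def using that b rho
      by (auto intro!: derivative_eq_intros simp: field_simps power2_eq_square)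
    define F' where "F' s y = (w' s y + (- c s) * ((norm y)\<^sup>2 * w s y)) * exp (- \<alpha> s * (norm y)\<^sup>2)" for s and y :: 'a
    have "\<bar>- c s\<bar> \<le> c b" if "s \<in> {0..b}" for s
      using power_mono[OF \<alpha>(2)[OF that], of 2] \<alpha>(3)[OF that] rho by (simp add: c_def)
    then have sgF: "subgauss {0..b} (\<lambda>s y. w' s y + (- c s) * ((norm y)\<^sup>2 * w s y))"
      by (intro subgauss_add subgauss_mult subgauss_power subgauss_norm
          subgauss_subset[OF sg(1) sub] subgauss_subset[OF sg(2) sub] subgauss_bounded)
    obtain C where C: "\<And>s y. s \<in> {0..b} \<Longrightarrow> \<bar>F' s y\<bar> \<le> C * exp (- (\<alpha> 0 / 2) * (norm y)\<^sup>2)"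
      using subgauss_weighted_bound[where \<alpha> = \<alpha>, OF sgF \<sigma>(3)[OF T] \<alpha>(1)] unfolding F'_def by blast
    have 1: "(I has_real_derivative (\<integral>y. F' t y \<partial>lborel)) (at t within {0..b})"
      unfolding I_def
    proof (rule has_real_derivative_integral[where W = "\<lambda>y. C * exp (- (\<alpha> 0 / 2) * (norm y)\<^sup>2)"])
      show "integrable lborel (\<lambda>y::'a. C * exp (- (\<alpha> 0 / 2) * (norm y)\<^sup>2))"
        using \<sigma>(3)[OF T] by (intro integrable_mult_right integrable_gaussian) auto
      show "integrable lborel (\<lambda>y. w s y * exp (- \<alpha> s * (norm y)\<^sup>2))" if "s \<in> {0..b}" for s
        using that sub \<alpha>(3)[OF that] by (intro integrable_subgauss_gaussian sg1 sg mw) auto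
      show "((\<lambda>s. w s y * exp (- \<alpha> s * (norm y)\<^sup>2)) has_real_derivative F' s y) (at s within {0..b})"
        if s: "s \<in> {0..b}" for s y
      proof -
        have "((\<lambda>s. w s y) has_real_derivative w' s y) (at s within {0..b})"
          using s sub by (intro DERIV_subset[OF dt]) auto
        then show ?thesis unfolding F'_def
          by (auto intro!: derivative_eq_intros d\<alpha>[OF s] simp: algebra_simps)
      qed
      show "F' t \<in> borel_measurable lborel" unfolding F'_def by measurable
    qed (use t C in auto)
    define g where "g y = exp (- \<alpha> t * (norm y)\<^sup>2)" for y :: 'a
    have int: "integrable lborel (\<lambda>y. h y * g y)" if "subgauss {()} (\<lambda>_. h)" "h \<in> borel_measurable borel" for h
      unfolding g_def using that \<sigma>(3)[OF tT(2)] by (rule integrable_subgauss_gaussian)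
    have "(\<integral>y. F' t y \<partial>lborel) = (\<integral>y. w' t y * g y - (c t * ((norm y)\<^sup>2 * w t y)) * g y \<partial>lborel)"
      by (intro Bochner_Integration.integral_cong) (auto simp: F'_def g_def algebra_simps)
    also have "\<dots> = (\<integral>y. w' t y * g y \<partial>lborel) - (\<integral>y. (c t * ((norm y)\<^sup>2 * w t y)) * g y \<partial>lborel)"
      by (intro Bochner_Integration.integral_diff int subgauss_mult subgauss_const subgauss_power subgauss_norm
          sg1[OF _ tT(1)] sg) measurable
    also have "(\<integral>y. w' t y * g y \<partial>lborel) = \<rho> * (\<integral>y. (\<Sum>b\<in>Basis. DD b t y) * g y \<partial>lborel)"
      by (simp add: heat[OF tT(1)] mult.assoc)
    also have "(\<integral>y. (\<Sum>b\<in>Basis. DD b t y) * g y \<partial>lborel)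
        = (\<integral>y. 2 * \<alpha> t * (2 * \<alpha> t * (norm y)\<^sup>2 - n) * w t y * g y \<partial>lborel)"
      unfolding g_def n_def
      by (rule gaussian_laplacian[OF \<sigma>(3)[OF tT(2)] dx[OF tT(1)] dxx[OF tT(1)]])
         (auto intro!: sg1[OF _ tT(1)] sg mD tT(1))
    also have "\<dots> = (\<integral>y. 4 * (\<alpha> t)\<^sup>2 * (((norm y)\<^sup>2 * w t y) * g y) - 2 * \<alpha> t * n * (w t y * g y) \<partial>lborel)"
      by (intro Bochner_Integration.integral_cong) (auto simp: algebra_simps power2_eq_square)
    also have "\<dots> = 4 * (\<alpha> t)\<^sup>2 * (\<integral>y. ((norm y)\<^sup>2 * w t y) * g y \<partial>lborel) - 2 * \<alpha> t * n * (\<integral>y. w t y * g y \<partial>lborel)"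
      by (subst Bochner_Integration.integral_diff)
         (auto intro!: integrable_mult_right int subgauss_mult subgauss_power subgauss_norm
          sg1[OF _ tT(1)] sg)
    also have "(\<integral>y. (c t * ((norm y)\<^sup>2 * w t y)) * g y \<partial>lborel) = c t * (\<integral>y. ((norm y)\<^sup>2 * w t y) * g y \<partial>lborel)"
      by (simp add: mult.assoc)
    \<comment> \<open>Since \<open>c t = 4 * \<rho> * (\<alpha> t)\<^sup>2\<close>, the terms with
      \<open>(norm y)\<^sup>2\<close> from the Laplacian and from the time derivative of the weight
      cancel; what is left reflects the missing normalisation of the kernel.\<close>
    finally have "(\<integral>y. F' t y \<partial>lborel) = - (2 * \<rho> * \<alpha> t * n) * I t"
      unfolding c_def I_def g_def by (simp add: algebra_simps)
    moreover have "2 * \<rho> * \<alpha> t * n = n * \<rho> / (\<sigma> t)\<^sup>2"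
      using rho tT(2) by (simp add: \<sigma>(2)[OF tT(2)] \<alpha>_def field_simps)
    ultimately show ?thesis using 1 by simp
  qed
  have HI: "H t = I t / \<sigma> t ^ n" if t: "t \<in> {0..<T}" for t
  proof -
    have tT: "t \<in> {0..T}" "t < T" using t by auto
    note [measurable] = mw[OF tT(1)]
    have "I t = \<sigma> t ^ n * (\<integral>z. w t (\<sigma> t *\<^sub>R z) * exp (- \<alpha> t * (norm (\<sigma> t *\<^sub>R z))\<^sup>2) \<partial>lborel)"
      unfolding I_def n_def by (rule lborel_integral_scale) (use \<sigma>(1)[OF tT(2)] in auto)
    also have "(\<integral>z. w t (\<sigma> t *\<^sub>R z) * exp (- \<alpha> t * (norm (\<sigma> t *\<^sub>R z))\<^sup>2) \<partial>lborel) = H t"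
      unfolding H_def
    proof (intro Bochner_Integration.integral_cong refl)
      fix z :: 'a
      have "\<alpha> t * (norm (\<sigma> t *\<^sub>R z))\<^sup>2 = \<alpha> t * (\<sigma> t)\<^sup>2 * (norm z)\<^sup>2"
        by (simp add: power_mult_distrib)
      also have "\<alpha> t * (\<sigma> t)\<^sup>2 = 1 / 2"
        using rho tT(2) by (simp add: \<sigma>(2) \<alpha>_def)
      finally show "w t (\<sigma> t *\<^sub>R z) * exp (- \<alpha> t * (norm (\<sigma> t *\<^sub>R z))\<^sup>2)
          = w t (\<sigma> t *\<^sub>R z) * exp (- (1 / 2) * (norm z)\<^sup>2)" by simp
    qed
    finally show ?thesis using \<sigma>(1)[OF tT(2)] by simp
  qed
  have const: "H b = H 0" if b: "b \<in> {0..<T}" for b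
  proof -
    have "\<exists>k. \<forall>t\<in>{0..b}. I t / \<sigma> t ^ n = k"
    proof (rule has_field_derivative_zero_constant)
      fix t assume t: "t \<in> {0..b}"
      then have tT: "t < T" using b by auto
      have s0: "\<sigma> t > 0" using \<sigma>(1)[OF tT] .
      have "(\<sigma> has_real_derivative - \<rho> / \<sigma> t) (at t within {0..b})"
        unfolding \<sigma>_def using tT rho
        by (auto intro!: derivative_eq_intros simp: field_simps)
      then have "((\<lambda>t. \<sigma> t ^ n) has_real_derivative n * \<sigma> t ^ (n - 1) * (- \<rho> / \<sigma> t)) (at t within {0..b})"
        by (auto intro!: derivative_eq_intros)
      \<comment> \<open>The exponent \<open>n - 1\<close> is safe because the dimension is
        positive.\<close>
      moreover have "\<sigma> t ^ n = \<sigma> t * \<sigma> t ^ (n - 1)"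
        unfolding n_def by (rule power_eq_if[THEN trans]) simp
      then have "n * \<sigma> t ^ (n - 1) * (- \<rho> / \<sigma> t) = - (n * \<rho> / (\<sigma> t)\<^sup>2) * \<sigma> t ^ n"
        using s0 by (simp add: field_simps power2_eq_square)
      ultimately have "((\<lambda>t. \<sigma> t ^ n) has_real_derivative - (n * \<rho> / (\<sigma> t)\<^sup>2) * \<sigma> t ^ n) (at t within {0..b})"
        by simp
      from DERIV_divide[OF I'[OF _ t] this] b s0
      show "((\<lambda>t. I t / \<sigma> t ^ n) has_real_derivative 0) (at t within {0..b})"
        by (simp add: algebra_simps)
    qed simp
    then show ?thesis using b HI[of b] HI[of 0] by auto
  qed
  \<comment> \<open>Starts at 0, stays strictly below \<open>T\<close>, where \<open>H\<close> is
    known to be constant, and tends to \<open>T\<close>.\<close>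
  define X where "X k = T - T / (real k + 1)" for k :: nat
  have X: "X k \<in> {0..<T}" for k using T by (auto simp: X_def field_simps)
  have Xlim: "X \<longlonglongrightarrow> T"
  proof -
    have "(\<lambda>k. T / (real k + 1)) \<longlonglongrightarrow> 0"
      using LIMSEQ_Suc[OF lim_const_over_n[of T]] by (simp add: add.commute)
    from tendsto_diff[OF tendsto_const[of T] this] show ?thesis by (simp add: X_def[abs_def])
  qed
  have \<sigma>lim: "(\<lambda>k. \<sigma> (X k)) \<longlonglongrightarrow> 0"
  proof -
    have "(\<lambda>k. \<sigma> (X k)) \<longlonglongrightarrow> sqrt (2 * \<rho> * (T - T))"
      unfolding \<sigma>_def by (intro tendsto_intros Xlim)
    then show ?thesis by simp
  qed
  have XT: "X k \<in> {0..T}" for k using X[of k] by auto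
  \<comment> \<open>In the rescaled form \<open>\<sigma> t <= \<sigma> 0\<close> gives one majorant
    for all times, including \<open>T\<close>.\<close>
  have sgs: "subgauss {0..T} (\<lambda>t z. w t (\<sigma> t *\<^sub>R z))"
  proof (rule subgauss_compose[OF sg(1)])
    fix t and z :: 'a assume "t \<in> {0..T}"
    then have "\<sigma> t \<le> \<sigma> 0" "0 \<le> \<sigma> t" using rho by (auto simp: \<sigma>_def)
    then show "norm (\<sigma> t *\<^sub>R z) \<le> 0 + \<sigma> 0 * norm z" by (simp add: mult_right_mono)
  qed
  obtain C where C: "\<And>t z. t \<in> {0..T} \<Longrightarrow>
      \<bar>w t (\<sigma> t *\<^sub>R z) * exp (- (1 / 2) * (norm z)\<^sup>2)\<bar> \<le> C * exp (- (1 / 2 / 2) * (norm z)\<^sup>2)"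
    using subgauss_weighted_bound[OF sgs, of "1/2" "\<lambda>_. 1/2"] by auto
  have "(\<lambda>k. H (X k)) \<longlonglongrightarrow> (\<integral>(z::'a). w T 0 * exp (- (1 / 2) * (norm z)\<^sup>2) \<partial>lborel)"
    unfolding H_def
  proof (rule integral_dominated_convergence[where w = "\<lambda>z. C * exp (- (1 / 2 / 2) * (norm z)\<^sup>2)"])
    show "integrable lborel (\<lambda>z::'a. C * exp (- (1 / 2 / 2) * (norm z)\<^sup>2))"
      by (intro integrable_mult_right integrable_gaussian) auto
    show "(\<lambda>z. w (X k) (\<sigma> (X k) *\<^sub>R z) * exp (- (1 / 2) * (norm z)\<^sup>2)) \<in> borel_measurable lborel" for k
      using mw[OF XT, of k] by measurable
    show "AE z in lborel. (\<lambda>k. w (X k) (\<sigma> (X k) *\<^sub>R z) * exp (- (1 / 2) * (norm z)\<^sup>2))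
        \<longlonglongrightarrow> w T 0 * exp (- (1 / 2) * (norm z)\<^sup>2)"
    proof (intro AE_I2 tendsto_intros)
      fix z :: 'a
      have "(\<lambda>k. (X k, \<sigma> (X k) *\<^sub>R z)) \<longlonglongrightarrow> (T, 0 *\<^sub>R z)"
        by (intro tendsto_intros Xlim \<sigma>lim)
      then have "(\<lambda>k. (\<lambda>(t, y). w t y) (X k, \<sigma> (X k) *\<^sub>R z)) \<longlonglongrightarrow> (\<lambda>(t, y). w t y) (T, 0 *\<^sub>R z)"
        using XT T by (intro continuous_on_tendsto_compose[OF cont]) auto
      then show "(\<lambda>k. w (X k) (\<sigma> (X k) *\<^sub>R z)) \<longlonglongrightarrow> w T 0" by simp
    qed
  qed (use C XT in auto)
  moreover have "(\<lambda>k. H (X k)) = (\<lambda>_. H 0)" using const[OF X] by auto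
  ultimately have "H 0 = (\<integral>(z::'a). w T 0 * exp (- (1 / 2) * (norm z)\<^sup>2) \<partial>lborel)"
    by (simp add: LIMSEQ_const_iff)
  then show ?thesis by (simp add: H_def \<sigma>_def mult.commute mult.left_commute)
qed

text \<open>The set of disagreement is open, and a nonempty open set is not Lebesgue null.\<close>

lemma continuous_AE_eq:
  fixes f g :: "'a::euclidean_space \<Rightarrow> real"
  assumes "continuous_on UNIV f" "continuous_on UNIV g" "AE x in lborel. f x = g x"
  shows "f x = g x"
proof (rule ccontr)
  assume ne: "f x \<noteq> g x"
  have "open {x. f x \<noteq> g x}"
    by (rule open_Collect_neq) (use assms in auto)
  moreover have "{x. f x \<noteq> g x} \<in> null_sets lborel"
    using assms(3) calculation by (subst AE_iff_null_sets) auto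
  ultimately show False
    using ne open_not_negligible negligible_iff_null_sets null_sets_completionI by blast
qed

section \<open>The standard normal law\<close>

definition std_normal :: "(real ^ 'n) measure" where
  "std_normal = density lborel (\<lambda>x. ennreal (exp (- (norm x)\<^sup>2 / 2) / sqrt (2 * pi) ^ CARD('n)))"

lemma sets_std_normal[simp, measurable_cong]: "sets std_normal = sets borel"
  and space_std_normal[simp]: "space std_normal = UNIV"
  by (simp_all add: std_normal_def)

lemma standard_normalD:
  assumes "standard_normal M X"
  shows "X \<in> measurable M borel" "distr M borel X = std_normal"
proof -
  show "X \<in> measurable M borel"
    using assms by (simp add: standard_normal_def distributed_def)
  have "distr M borel X = distr M lborel X" by (rule distr_cong) auto
  then show "distr M borel X = std_normal"
    using assms by (simp add: standard_normal_def distributed_def std_normal_def)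
qed

lemma integral_std_normal:
  fixes f :: "real ^ 'n \<Rightarrow> real"
  assumes "f \<in> borel_measurable borel"
  shows "(\<integral>x. f x \<partial>std_normal) = (\<integral>x. f x * exp (- (1 / 2) * (norm x)\<^sup>2) \<partial>lborel) / sqrt (2 * pi) ^ CARD('n)"
  unfolding std_normal_def using assms
  by (subst integral_density) (auto simp: mult.commute simp flip: integral_divide_zero)

lemma integrable_std_normal:
  fixes f :: "real ^ 'n \<Rightarrow> real"
  assumes "subgauss {()} (\<lambda>_. f)" "f \<in> borel_measurable borel"
  shows "integrable std_normal f"
proof -
  have "integrable lborel (\<lambda>x. f x * exp (- (1 / 2) * (norm x)\<^sup>2) / sqrt (2 * pi) ^ CARD('n))"
    using assms by (intro integrable_divide integrable_subgauss_gaussian) auto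
  then show ?thesis unfolding std_normal_def using assms(2)
    by (subst integrable_density) (auto simp: mult.commute)
qed

text \<open>The rate 1/4 is half the rate of the density, so an integrable Gaussian of rate 1/4
  remains. It supplies the finiteness of the minimal loss.\<close>

lemma nn_integral_std_normal_exp:
  "(\<integral>\<^sup>+ (x::real ^ 'n). ennreal (exp (1 / 4 * (norm x)\<^sup>2)) \<partial>std_normal) < \<infinity>"
proof -
  have "(\<integral>\<^sup>+ (x::real ^ 'n). ennreal (exp (1 / 4 * (norm x)\<^sup>2)) \<partial>std_normal)
      = (\<integral>\<^sup>+ (x::real ^ 'n). ennreal (exp (- (1 / 4) * (norm x)\<^sup>2) / sqrt (2 * pi) ^ CARD('n)) \<partial>lborel)"
    unfolding std_normal_def
  proof (subst nn_integral_density)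
    show "(\<integral>\<^sup>+ (x::real ^ 'n). ennreal (exp (- (norm x)\<^sup>2 / 2) / sqrt (2 * pi) ^ CARD('n)) * ennreal (exp (1 / 4 * (norm x)\<^sup>2)) \<partial>lborel)
      = (\<integral>\<^sup>+ (x::real ^ 'n). ennreal (exp (- (1 / 4) * (norm x)\<^sup>2) / sqrt (2 * pi) ^ CARD('n)) \<partial>lborel)"
      by (intro nn_integral_cong) (simp add: field_simps flip: ennreal_mult exp_add)
  qed auto
  also have "\<dots> < \<infinity>"
    using integrable_divide[OF integrable_gaussian[of "1/4", where 'a = "real ^ 'n"], of "sqrt (2 * pi) ^ CARD('n)"]
    by (auto simp: integrable_iff_bounded)
  finally show ?thesis .
qed

section \<open>Applying the heat flow argument to \<open>u\<close>\<close>

lemma continuous_on_slice: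
  assumes "continuous_on (S \<times> UNIV) (\<lambda>(t, x). f t x)" "t \<in> S"
  shows "continuous_on UNIV (f t)"
proof -
  have "continuous_on UNIV (\<lambda>x. (\<lambda>(t, x). f t x) (t, x))"
    by (rule continuous_on_compose2[OF assms(1)]) (use assms(2) in \<open>auto intro!: continuous_intros\<close>)
  then show ?thesis by simp
qed

lemma has_partialD:
  "has_partial i f x \<Longrightarrow> ((\<lambda>h. f (x + h *\<^sub>R axis i 1)) has_real_derivative partial i f x) (at 0)"
  unfolding has_partial_def partial_def by (simp add: DERIV_deriv_iff_real_differentiable)

lemma Basis_vec_range: "(Basis :: (real ^ 'n) set) = range (\<lambda>i. axis i 1)"
  by (auto simp: Basis_vec_def)

text \<open>For \<open>u\<close> itself, compactness of \<open>{0..T}\<close> bounds the values at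
  the origin, and the partial derivatives propagate the bound.\<close>

lemma subgauss_C12:
  fixes u :: "real \<Rightarrow> real ^ 'n \<Rightarrow> real"
  assumes "u \<in> C12 T" "poly_growing_derivs T u"
  shows "subgauss {0..T} (time_deriv T u)"
    and "subgauss {0..T} (\<lambda>t. partial i (u t))"
    and "subgauss {0..T} (\<lambda>t. partial j (partial i (u t)))"
    and "subgauss {0..T} u"
proof -
  obtain c where c: "c > 0" "\<And>t x. t \<in> {0..T} \<Longrightarrow> \<bar>time_deriv T u t x\<bar> \<le> c * (1 + norm x powr c)"
    "\<And>t x i. t \<in> {0..T} \<Longrightarrow> \<bar>partial i (u t) x\<bar> \<le> c * (1 + norm x powr c)"
    "\<And>t x i j. t \<in> {0..T} \<Longrightarrow> \<bar>partial j (partial i (u t)) x\<bar> \<le> c * (1 + norm x powr c)"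
    using assms(2) unfolding poly_growing_derivs_def by blast
  show "subgauss {0..T} (time_deriv T u)" using c(1,2) by (rule subgauss_poly)
  show p: "subgauss {0..T} (\<lambda>t. partial i (u t))" for i using c(1,3) by (rule subgauss_poly)
  show "subgauss {0..T} (\<lambda>t. partial j (partial i (u t)))" using c(1,4) by (rule subgauss_poly)
  have "continuous_on {0..T} (\<lambda>t. (\<lambda>(t, x). u t x) (t, 0))"
    by (rule continuous_on_compose2[of "{0..T} \<times> UNIV"])
       (use assms(1) in \<open>auto intro!: continuous_intros simp: C12_def\<close>)
  then have "bounded ((\<lambda>t. u t 0) ` {0..T})"
    by (intro compact_imp_bounded compact_continuous_image) auto
  then obtain K where K: "\<forall>t\<in>{0..T}. \<bar>u t 0\<bar> \<le> K"
    unfolding bounded_iff by auto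
  show "subgauss {0..T} u"
  proof (rule subgauss_from_partials[where D = "\<lambda>b t y. deriv (\<lambda>h. u t (y + h *\<^sub>R b)) 0"])
    show "((\<lambda>h. u t (y + h *\<^sub>R b)) has_real_derivative deriv (\<lambda>h. u t (y + h *\<^sub>R b)) 0) (at 0)"
      if "t \<in> {0..T}" "b \<in> Basis" for t y b
      using assms(1) that has_partialD unfolding C12_def Basis_vec_range partial_def by blast
    show "subgauss {0..T} (\<lambda>t y. deriv (\<lambda>h. u t (y + h *\<^sub>R b)) 0)" if "b \<in> Basis" for b
      using that p unfolding Basis_vec_range partial_def by auto
  qed (use K in auto)
qed

text \<open>Apply \<open>heat_gaussian_mean\<close> to the translate \<open>u t (x + y)\<close>,
  then divide by the Gaussian mass.\<close>

lemma heat_flow_std_normal: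
  fixes u :: "real \<Rightarrow> real ^ 'n \<Rightarrow> real"
  assumes T: "T > 0" and rho: "\<rho> > 0" and u: "u \<in> C12 T" and grow: "poly_growing_derivs T u"
    and heat: "\<And>t x. t \<in> {0..T} \<Longrightarrow> time_deriv T u t x = \<rho> * laplacian (u t) x"
    and prob: "prob_space (std_normal :: (real ^ 'n) measure)"
  shows "(\<integral>z. u 0 (x + sqrt (2 * T * \<rho>) *\<^sub>R z) \<partial>std_normal) = u T x"
proof -
  \<comment> \<open>Passes from coordinates to basis vectors as indices: at \<open>axis i 1\<close>
    these are the derivatives \<open>partial i\<close>.\<close>
  define D where "D b t y = deriv (\<lambda>h. u t (y + h *\<^sub>R b)) 0" for b t and y :: "real ^ 'n"
  define DD where "DD b t y = deriv (\<lambda>h. D b t (y + h *\<^sub>R b)) 0" for b t and y :: "real ^ 'n"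
  have D: "D (axis i 1) t = partial i (u t)" for i t
    by (simp add: D_def partial_def fun_eq_iff)
  have DD: "DD (axis i 1) t = partial i (partial i (u t))" for i t
    by (simp add: DD_def D partial_def[of _ "partial i (u t)"] fun_eq_iff)
  have cont: "continuous_on ({0..T} \<times> UNIV) (\<lambda>(t, y). u t y)"
    using u by (simp add: C12_def)
  have m: "f \<in> borel_measurable borel" if "continuous_on UNIV f" for f :: "real ^ 'n \<Rightarrow> real"
    using that by (rule borel_measurable_continuous_onI)
  have c: "continuous_on UNIV (u t)" "continuous_on UNIV (time_deriv T u t)"
    "continuous_on UNIV (partial i (u t))" "continuous_on UNIV (partial j (partial i (u t)))"
    if "t \<in> {0..T}" for t i j
    using u that by (auto simp: C12_def intro: continuous_on_slice[of "{0..T}"])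
  note [measurable] = m[OF c(1)] m[OF c(2)] m[OF c(3)] m[OF c(4)]
  have m0[measurable]: "u 0 \<in> borel_measurable borel" using T by simp
  have shift: "subgauss {0..T} (\<lambda>t y. f t (x + y))" if "subgauss {0..T} f" for f :: "real \<Rightarrow> real ^ 'n \<Rightarrow> real"
    by (rule subgauss_compose[OF that, of _ "norm x" 1]) (simp add: norm_triangle_ineq)
  note sg = subgauss_C12[OF u grow]
  have "(\<integral>z. u 0 (x + sqrt (2 * T * \<rho>) *\<^sub>R z) * exp (- (1 / 2) * (norm z)\<^sup>2) \<partial>lborel)
      = u T (x + 0) * (\<integral>(z::real ^ 'n). exp (- (1 / 2) * (norm z)\<^sup>2) \<partial>lborel)"
  proof (rule heat_gaussian_mean[OF T rho, where w = "\<lambda>t y. u t (x + y)" and w' = "\<lambda>t y. time_deriv T u t (x + y)"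
        and D = "\<lambda>b t y. D b t (x + y)" and DD = "\<lambda>b t y. DD b t (x + y)"])
    have "continuous_on ({0..T} \<times> UNIV) (\<lambda>p. (\<lambda>(t, y). u t y) (fst p, x + snd p))"
      by (rule continuous_on_compose2[OF cont]) (auto intro!: continuous_intros)
    then show "continuous_on ({0..T} \<times> UNIV) (\<lambda>(t, y). u t (x + y))"
      by (simp add: case_prod_beta)
    show "((\<lambda>s. u s (x + y)) has_real_derivative time_deriv T u t (x + y)) (at t within {0..T})"
      if "t \<in> {0..T}" for t y
    proof -
      have "(\<lambda>s. u s (x + y)) differentiable (at t within {0..T})" using u that by (simp add: C12_def)
      then show ?thesis unfolding time_deriv_def
        by (simp add: vector_derivative_works has_real_derivative_iff_has_vector_derivative)
    qed
    show "((\<lambda>h. u t (x + (y + h *\<^sub>R b))) has_real_derivative D b t (x + y)) (at 0)"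
      if tb: "t \<in> {0..T}" "b \<in> Basis" for t y b
    proof -
      obtain i where b: "b = axis i 1" using tb(2) by (auto simp: Basis_vec_range)
      have "has_partial i (u t) (x + y)" using u tb(1) by (simp add: C12_def)
      from has_partialD[OF this] show ?thesis unfolding b D by (simp add: add.assoc)
    qed
    show "((\<lambda>h. D b t (x + (y + h *\<^sub>R b))) has_real_derivative DD b t (x + y)) (at 0)"
      if tb: "t \<in> {0..T}" "b \<in> Basis" for t y b
    proof -
      obtain i where b: "b = axis i 1" using tb(2) by (auto simp: Basis_vec_range)
      have "has_partial i (partial i (u t)) (x + y)" using u tb(1) by (simp add: C12_def)
      from has_partialD[OF this] show ?thesis unfolding b D DD by (simp add: add.assoc)
    qed
    show "(\<lambda>y. time_deriv T u t (x + y)) \<in> borel_measurable borel" if "t \<in> {0..T}" for t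
      using that by measurable
    show "(\<lambda>y. D b t (x + y)) \<in> borel_measurable borel" "(\<lambda>y. DD b t (x + y)) \<in> borel_measurable borel"
      if "t \<in> {0..T}" "b \<in> Basis" for t b
      using that m[OF c(3)[OF that(1)]] m[OF c(4)[OF that(1)]] by (auto simp: Basis_vec_range D DD)
    show "subgauss {0..T} (\<lambda>t y. u t (x + y))" "subgauss {0..T} (\<lambda>t y. time_deriv T u t (x + y))"
      by (intro shift sg)+
    show "subgauss {0..T} (\<lambda>t y. D b t (x + y))" "subgauss {0..T} (\<lambda>t y. DD b t (x + y))" if "b \<in> Basis" for b
      using that by (auto simp: Basis_vec_range D DD intro!: shift sg)
    show "time_deriv T u t (x + y) = \<rho> * (\<Sum>b\<in>Basis. DD b t (x + y))" if "t \<in> {0..T}" for t y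
      unfolding Basis_vec_range
      by (subst sum.reindex) (auto simp: heat[OF that] laplacian_def DD axis_eq_axis inj_on_def)
  qed
  \<comment> \<open>The Gaussian integral is not computed; its value is read off from the total mass
    1 of \<open>std_normal\<close>.\<close>
  moreover have "(\<integral>(z::real ^ 'n). exp (- (1 / 2) * (norm z)\<^sup>2) \<partial>lborel) / sqrt (2 * pi) ^ CARD('n) = 1"
  proof -
    have "(\<integral>(z::real ^ 'n). (1::real) \<partial>std_normal) = 1"
      using prob_space.prob_space[OF prob] by simp
    then show ?thesis by (subst (asm) integral_std_normal) auto
  qed
  ultimately show ?thesis by (subst integral_std_normal) (auto simp: mult.assoc[symmetric] simp flip: times_divide_eq_right)
qed

section \<open>Decomposition and minimisation of the loss\<close>

text \<open>The cross term vanishes because \<open>m\<close> is the mean. Nonnegative integrals make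
  the identity fit under an outer integral that may be infinite.\<close>

lemma (in prob_space) bias_variance:
  fixes h :: "'a \<Rightarrow> real"
  assumes "integrable M h" "integrable M (\<lambda>x. (h x)\<^sup>2)" and m: "expectation h = m"
  shows "(\<integral>\<^sup>+ x. ennreal ((h x - v)\<^sup>2) \<partial>M) = (\<integral>\<^sup>+ x. ennreal ((h x - m)\<^sup>2) \<partial>M) + ennreal ((m - v)\<^sup>2)"
proof -
  have eq: "(\<lambda>x. (h x - c)\<^sup>2) = (\<lambda>x. (h x)\<^sup>2 - 2 * c * h x + c\<^sup>2)" for c
    by (auto simp: power2_diff algebra_simps)
  have int: "integrable M (\<lambda>x. (h x - c)\<^sup>2)" for c
    unfolding eq using assms by auto
  have E: "expectation (\<lambda>x. (h x - c)\<^sup>2) = expectation (\<lambda>x. (h x)\<^sup>2) - 2 * c * m + c\<^sup>2" for c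
    unfolding eq using assms by (simp add: prob_space)
  have N: "(\<integral>\<^sup>+ x. ennreal ((h x - c)\<^sup>2) \<partial>M) = ennreal (expectation (\<lambda>x. (h x - c)\<^sup>2))" for c
    using int by (intro nn_integral_eq_integral) auto
  have "expectation (\<lambda>x. (h x - v)\<^sup>2) = expectation (\<lambda>x. (h x - m)\<^sup>2) + (m - v)\<^sup>2"
    unfolding E by (simp add: power2_eq_square algebra_simps)
  then show ?thesis unfolding N by (simp add: ennreal_plus)
qed

theorem theorem3p11:
  fixes T \<rho> \<rho>' :: real
    and \<phi> :: "real ^ 'n \<Rightarrow> real"
    and u :: "real \<Rightarrow> real ^ 'n \<Rightarrow> real"
    and M :: "'w measure"
    and B \<xi> :: "'w \<Rightarrow> real ^ 'n"
    and V :: "(real ^ 'n \<Rightarrow> real) set"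
    and \<l> :: "(real ^ 'n \<Rightarrow> real) \<Rightarrow> ennreal"
  assumes "T > 0" and "\<rho> > 0"
    and "\<rho>' = sqrt (2 * T * \<rho>)"
    and "u \<in> C12 T"
    and "poly_growing_derivs T u"
    and "\<And>x. u 0 x = \<phi> x"
    and "\<And>t x. t \<in> {0..T} \<Longrightarrow> time_deriv T u t x = \<rho> * laplacian (u t) x"
    and "prob_space M"
    and "standard_normal M B"
    and "standard_normal M \<xi>"
    and "prob_space.indep_var M borel B borel \<xi>"
    and "V = {v. continuous_on UNIV v}"
    and "\<And>v. v \<in> V \<Longrightarrow>
           \<l> v = (\<integral>\<^sup>+ \<omega>. ennreal (\<bar>\<phi> (\<rho>' *\<^sub>R B \<omega> + \<xi> \<omega>) - v (\<xi> \<omega>)\<bar>\<^sup>2) \<partial>M)"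
  shows "(\<forall>v\<in>V. (\<l> v = (INF w\<in>V. \<l> w)) \<longleftrightarrow> (\<forall>x. v x = u T x)) \<and>
         (\<exists>v\<in>V. \<l> v = (INF w\<in>V. \<l> w))"
proof -
  interpret M: prob_space M by fact
  let ?N = "std_normal :: (real ^ 'n) measure"
  note B = standard_normalD[OF assms(9)] and \<xi> = standard_normalD[OF assms(10)]
  note [measurable] = B(1) \<xi>(1)
  have probN: "prob_space ?N" using M.prob_space_distr[OF B(1)] by (simp add: B(2))
  interpret N: prob_space ?N by (rule probN)
  interpret NN: pair_sigma_finite ?N ?N by standard
  have \<phi>: "\<phi> = u 0" using assms(6) by auto
  have tT: "0 \<in> {0..T}" "T \<in> {0..T}" using assms(1) by auto
  have contu: "continuous_on UNIV (u t)" if "t \<in> {0..T}" for t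
    using assms(4) that by (auto simp: C12_def intro: continuous_on_slice[of "{0..T}"])
  have [measurable]: "\<phi> \<in> borel_measurable borel" "u T \<in> borel_measurable borel"
    unfolding \<phi> by (intro borel_measurable_continuous_onI contu tT)+
  have sg\<phi>: "subgauss {()} (\<lambda>_. \<phi>)"
    unfolding \<phi> by (rule subgauss_at[OF subgauss_C12(4)[OF assms(4,5)] tT(1)])
  have sgh: "subgauss {()} (\<lambda>_ b. \<phi> (\<rho>' *\<^sub>R b + x))" for x
    by (rule subgauss_compose[OF sg\<phi>, of _ "norm x" "\<bar>\<rho>'\<bar>"])
       (metis add.commute norm_scaleR norm_triangle_ineq)
  have mean: "(\<integral>b. \<phi> (\<rho>' *\<^sub>R b + x) \<partial>?N) = u T x" for x
    using heat_flow_std_normal[OF assms(1,2,4,5,7) probN, of x] by (simp add: \<phi> assms(3) add.commute)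
  have bv: "(\<integral>\<^sup>+ b. ennreal ((\<phi> (\<rho>' *\<^sub>R b + x) - c)\<^sup>2) \<partial>?N)
      = (\<integral>\<^sup>+ b. ennreal ((\<phi> (\<rho>' *\<^sub>R b + x) - u T x)\<^sup>2) \<partial>?N) + ennreal ((u T x - c)\<^sup>2)" for x c
    by (intro N.bias_variance mean integrable_std_normal sgh subgauss_power) measurable
  \<comment> \<open>The irreducible part of the loss: the mean conditional variance of
    \<open>\<phi> (\<rho>' *\<^sub>R B + \<xi>)\<close> given \<open>\<xi>\<close>.\<close>
  define K where "K = (\<integral>\<^sup>+ x. \<integral>\<^sup>+ b. ennreal ((\<phi> (\<rho>' *\<^sub>R b + x) - u T x)\<^sup>2) \<partial>?N \<partial>?N)"
  have loss: "\<l> v = K + (\<integral>\<^sup>+ x. ennreal ((u T x - v x)\<^sup>2) \<partial>?N)" if v: "v \<in> V" for v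
  proof -
    have [measurable]: "v \<in> borel_measurable borel"
      using v assms(12) by (auto intro: borel_measurable_continuous_onI)
    \<comment> \<open>Independence turns the joint law into a product; Tonelli then puts the
      variable of \<open>\<xi>\<close> outside, where \<open>v x\<close> is a constant for the inner
      integral.\<close>
    have J: "?N \<Otimes>\<^sub>M ?N = distr M (borel \<Otimes>\<^sub>M borel) (\<lambda>\<omega>. (B \<omega>, \<xi> \<omega>))"
      using assms(11) unfolding M.indep_var_distribution_eq B(2) \<xi>(2) by simp
    have "\<l> v = (\<integral>\<^sup>+ p. ennreal ((\<phi> (\<rho>' *\<^sub>R fst p + snd p) - v (snd p))\<^sup>2)
        \<partial>distr M (borel \<Otimes>\<^sub>M borel) (\<lambda>\<omega>. (B \<omega>, \<xi> \<omega>)))"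
      by (subst nn_integral_distr) (auto simp: assms(13)[OF v])
    also have "\<dots> = (\<integral>\<^sup>+ x. \<integral>\<^sup>+ b. ennreal ((\<phi> (\<rho>' *\<^sub>R b + x) - v x)\<^sup>2) \<partial>?N \<partial>?N)"
      unfolding J[symmetric] by (subst NN.nn_integral_snd[symmetric]) auto
    also have "\<dots> = (\<integral>\<^sup>+ x. (\<integral>\<^sup>+ b. ennreal ((\<phi> (\<rho>' *\<^sub>R b + x) - u T x)\<^sup>2) \<partial>?N)
        + ennreal ((u T x - v x)\<^sup>2) \<partial>?N)"
      by (intro nn_integral_cong bv)
    also have "\<dots> = K + (\<integral>\<^sup>+ x. ennreal ((u T x - v x)\<^sup>2) \<partial>?N)"
      unfolding K_def by (rule nn_integral_add) auto
    finally show ?thesis .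
  qed
  have Kfin: "K < \<infinity>"
  proof -
    \<comment> \<open>After the factor 2 from squaring a sum, the rates in \<open>x\<close> and
      \<open>b\<close> become \<open>2 * a\<close> and \<open>2 * a * \<rho>'\<^sup>2\<close>; both
      must stay below the rate 1/4 that is integrable under the normal law.\<close>
    define a where "a = 1 / (8 * (1 + \<rho>'\<^sup>2))"
    have pos: "1 + \<rho>'\<^sup>2 > 0" by (simp add: add_pos_nonneg)
    have a: "a > 0" "2 * a \<le> 1 / 4" "2 * a * \<rho>'\<^sup>2 \<le> 1 / 4"
      using pos by (auto simp: a_def field_simps)
    obtain C where C: "C \<ge> 0" "\<And>y. (\<phi> y)\<^sup>2 \<le> C * exp (a * (norm y)\<^sup>2)"
      using subgaussD[OF subgauss_power[OF sg\<phi>, of 2] a(1)] by auto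
    have bound: "(\<phi> (\<rho>' *\<^sub>R b + x))\<^sup>2 \<le> C * exp (1 / 4 * (norm b)\<^sup>2) * exp (1 / 4 * (norm x)\<^sup>2)" for b x
    proof -
      have "a * (norm (\<rho>' *\<^sub>R b + x))\<^sup>2 \<le> a * (2 * (norm (\<rho>' *\<^sub>R b))\<^sup>2 + 2 * (norm x)\<^sup>2)"
        using a(1) by (intro mult_left_mono norm_add_sq_le) auto
      also have "\<dots> = (2 * a * \<rho>'\<^sup>2) * (norm b)\<^sup>2 + (2 * a) * (norm x)\<^sup>2"
        by (simp add: power_mult_distrib algebra_simps)
      also have "\<dots> \<le> 1 / 4 * (norm b)\<^sup>2 + 1 / 4 * (norm x)\<^sup>2"
        using a by (intro add_mono mult_right_mono) auto
      finally have "exp (a * (norm (\<rho>' *\<^sub>R b + x))\<^sup>2) \<le> exp (1 / 4 * (norm b)\<^sup>2) * exp (1 / 4 * (norm x)\<^sup>2)"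
        unfolding exp_add[symmetric] by simp
      from mult_left_mono[OF this C(1)] C(2)[of "\<rho>' *\<^sub>R b + x"] show ?thesis by (simp add: mult.assoc)
    qed
    \<comment> \<open>The variance is at most the second moment: \<open>bv\<close> with
      \<open>c = 0\<close>.\<close>
    have "K \<le> (\<integral>\<^sup>+ x. \<integral>\<^sup>+ b. ennreal ((\<phi> (\<rho>' *\<^sub>R b + x) - 0)\<^sup>2) \<partial>?N \<partial>?N)"
      unfolding K_def
    proof (rule nn_integral_mono)
      fix x
      show "(\<integral>\<^sup>+ b. ennreal ((\<phi> (\<rho>' *\<^sub>R b + x) - u T x)\<^sup>2) \<partial>?N)
          \<le> (\<integral>\<^sup>+ b. ennreal ((\<phi> (\<rho>' *\<^sub>R b + x) - 0)\<^sup>2) \<partial>?N)"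
        by (subst (2) bv) simp
    qed
    also have "\<dots> \<le> (\<integral>\<^sup>+ (x::real ^ 'n). \<integral>\<^sup>+ (b::real ^ 'n). ennreal C * ennreal (exp (1 / 4 * (norm b)\<^sup>2))
        * ennreal (exp (1 / 4 * (norm x)\<^sup>2)) \<partial>?N \<partial>?N)"
      using bound C(1) by (intro nn_integral_mono) (simp flip: ennreal_mult)
    also have "\<dots> = ennreal C * (\<integral>\<^sup>+ b. ennreal (exp (1 / 4 * (norm b)\<^sup>2)) \<partial>?N)
        * (\<integral>\<^sup>+ x. ennreal (exp (1 / 4 * (norm x)\<^sup>2)) \<partial>?N)"
      by (simp add: nn_integral_cmult nn_integral_multc)
    also have "\<dots> < \<infinity>"
      using nn_integral_std_normal_exp[where 'n = 'n] by (simp add: ennreal_mult_less_top)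
    finally show ?thesis .
  qed
  have uV: "u T \<in> V" using contu[OF tT(2)] assms(12) by simp
  have lu: "\<l> (u T) = K" using loss[OF uV] by simp
  have inf: "(INF w\<in>V. \<l> w) = K"
  proof (rule antisym)
    show "(INF w\<in>V. \<l> w) \<le> K" using INF_lower[OF uV, of \<l>] lu by simp
    show "K \<le> (INF w\<in>V. \<l> w)" by (rule INF_greatest) (simp add: loss)
  qed
  have "\<l> v = K \<longleftrightarrow> (\<forall>x. v x = u T x)" if v: "v \<in> V" for v
  proof
    assume "\<forall>x. v x = u T x"
    then have "v = u T" by auto
    then show "\<l> v = K" using lu by simp
  next
    assume "\<l> v = K"
    have cv: "continuous_on UNIV v" using v assms(12) by simp
    then have [measurable]: "v \<in> borel_measurable borel" by (rule borel_measurable_continuous_onI)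
    have "K + (\<integral>\<^sup>+ x. ennreal ((u T x - v x)\<^sup>2) \<partial>?N) = K + 0"
      using loss[OF v] \<open>\<l> v = K\<close> by simp
    then have "(\<integral>\<^sup>+ x. ennreal ((u T x - v x)\<^sup>2) \<partial>?N) = 0"
      using Kfin unfolding ennreal_add_left_cancel by auto
    then have "AE x in ?N. ennreal ((u T x - v x)\<^sup>2) = 0"
      by (subst (asm) nn_integral_0_iff_AE) auto
    \<comment> \<open>The normal density is strictly positive, so an exceptional null set of the law
      is Lebesgue null.\<close>
    then have "AE x in lborel. v x = u T x"
      unfolding std_normal_def by (subst (asm) AE_density) auto
    then show "\<forall>x. v x = u T x"
      using continuous_AE_eq[OF cv contu[OF tT(2)]] by blast
  qed
  then show ?thesis unfolding inf using uV lu by blast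
qed

end
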